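(* Let $n>k\ge3$, and let $G_S=G_{S_{n-k+1}}$ and $G_P=G_{P_{n-k+1}}$, the maximal and minimal elements of the $\mathrm{GGS}_n$ poset on $\Omega_{C_k}^v(n)$. Then, among the graphs in $\Omega_{C_k}^v(n)$, $(G_S,G_P)$ is the max-min pair for the spectral radius and $(G_P,G_S)$ is the max-min pair for the Wiener index; that is, for every $G\in\Omega_{C_k}^v(n)$, $$\sigma(G_P)\le\sigma(G)\le\sigma(G_S)\quad\text{and}\quad W(G_S)\le W(G)\le W(G_P).$$
   Context: $\sigma(G)$ is the largest eigenvalue of the adjacency matrix of $G$. $W(G)=\sum_{i,j\in G}d_G(i,j)$ is the Wiener index, where $d_G$ is shortest-path distance. $\Omega_{C_k}^v(n)$ is the set of unlabelled simple connected unicyclic graphs on $n$ vertices whose unique cycle $C_k$ has length $k$ and in which every vertex of $C_k$ has degree 2 except one vertex $v$ of $C_k$. $G_{S_{n-k+1}}$ is the graph obtained from the cycle $C_k$ and the star on $n-k+1$ vertices by identifying a vertex of the cycle with the centre (the vertex of degree $n-k$) of the star. $G_{P_{n-k+1}}$ is the graph obtained from $C_k$ and the path on $n-k+1$ vertices by identifying a vertex of the cycle with an end vertex of the path. The $\mathrm{GGS}_n$ partial order on $\Omega_{C_k}^v(n)$: $G_1\le_{\mathrm{GGS}_n}G_2$ if $G_2$ is obtained from $G_1$ by some number of generalized graph shifts. A generalized graph shift of $G_1$ is performed as follows: choose two distinct vertices $u$ and $w$ connected by a path $P$ whose interior vertices (if any) have degree 2 in $G_1$, with $u,w$ not both contained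 in one cycle of $G_1$; let $w'$ be the neighbour of $w$ on $P$; for each neighbour $z\ne w'$ of $w$, delete the edge $\{w,z\}$ and add the edge $\{u,z\}$. *)

theory Defs
  imports "Graph_Theory.Graph_Theory" "Jordan_Normal_Form.Spectral_Radius"
begin

text \<open>A finite simple graph is a \<^term>\<open>pair_graph\<close>: each edge is stored as two opposite arcs.
  Unlabelled graphs on n vertices are represented by all their labellings by \<^term>\<open>{..<n}\<close>,
  and equality of unlabelled graphs is isomorphism.\<close>

definition graph_iso :: "'a pair_pre_digraph \<Rightarrow> 'b pair_pre_digraph \<Rightarrow> bool" where
  "graph_iso G H \<longleftrightarrow> digraph_iso (with_proj G) (with_proj H)"

definition graph_degree :: "'a pair_pre_digraph \<Rightarrow> 'a \<Rightarrow> nat" where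
  "graph_degree G v = out_degree (with_proj G) v"

definition neighbours :: "'a pair_pre_digraph \<Rightarrow> 'a \<Rightarrow> 'a set" where
  "neighbours G v = {z. (v, z) \<in> parcs G}"

text \<open>The rows are indexed by the vertices themselves, so the vertex set has to be an
  initial segment of the naturals. The matrix is then real symmetric, hence all its eigenvalues
  are real and the real spectrum is the whole spectrum.\<close>

definition adj_matrix :: "nat pair_pre_digraph \<Rightarrow> real mat" where
  "adj_matrix G = mat (card (pverts G)) (card (pverts G))
     (\<lambda>(i, j). if (i, j) \<in> parcs G then 1 else 0)"

definition adj_sigma :: "nat pair_pre_digraph \<Rightarrow> real" where
  "adj_sigma G = Max (spectrum (adj_matrix G))"

text \<open>The shortest-path distance is the infimum of the walk costs for unit arc weights; it is
  finite exactly when a walk exists. The Wiener index sums over ordered pairs of vertices.\<close>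

definition graph_dist :: "'a pair_pre_digraph \<Rightarrow> 'a \<Rightarrow> 'a \<Rightarrow> ereal" where
  "graph_dist G = wf_digraph.\<mu> (with_proj G) (\<lambda>_. 1)"

definition wiener :: "'a pair_pre_digraph \<Rightarrow> ereal" where
  "wiener G = (\<Sum>i\<in>pverts G. \<Sum>j\<in>pverts G. graph_dist G i j)"

text \<open>The length bound excludes the closed walks that traverse a single edge back and forth,
  which are cycles of the bidirected digraph but not of the undirected graph.\<close>

definition graph_cycle :: "'a pair_pre_digraph \<Rightarrow> ('a \<times> 'a) list \<Rightarrow> bool" where
  "graph_cycle G c \<longleftrightarrow> pre_digraph.cycle (with_proj G) c \<and> length c \<ge> 3"

text \<open>Uniqueness of a cycle is uniqueness of its set of undirected edges, that is, up to the
  choice of the starting vertex and of the orientation.\<close>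

definition cycle_edges :: "('a \<times> 'a) list \<Rightarrow> 'a set set" where
  "cycle_edges c = (\<lambda>(x, y). {x, y}) ` set c"

definition cycle_verts :: "('a \<times> 'a) list \<Rightarrow> 'a set" where
  "cycle_verts c = fst ` set c"

definition unicyclic :: "'a pair_pre_digraph \<Rightarrow> bool" where
  "unicyclic G \<longleftrightarrow> (\<exists>!E. \<exists>c. graph_cycle G c \<and> cycle_edges c = E)"

definition Omega :: "nat \<Rightarrow> nat \<Rightarrow> nat pair_pre_digraph set" where
  "Omega k n = {G. pair_graph G \<and> pverts G = {..<n} \<and> connected (with_proj G) \<and> unicyclic G \<and>
     (\<exists>c. graph_cycle G c \<and> length c = k \<and> (\<exists>!v. v \<in> cycle_verts c \<and> graph_degree G v \<noteq> 2))}"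

definition cycle_graph :: "nat \<Rightarrow> nat pair_pre_digraph" where
  "cycle_graph k = \<lparr> pverts = {..<k},
     parcs = {(i, j). i < k \<and> j < k \<and> (j = (i + 1) mod k \<or> i = (j + 1) mod k)} \<rparr>"

definition path_graph :: "nat \<Rightarrow> nat pair_pre_digraph" where
  "path_graph m = \<lparr> pverts = {..<m},
     parcs = {(i, j). i < m \<and> j < m \<and> (j = i + 1 \<or> i = j + 1)} \<rparr>"

definition star_graph :: "nat \<Rightarrow> nat pair_pre_digraph" where
  "star_graph m = \<lparr> pverts = {..<m},
     parcs = {(i, j). i < m \<and> j < m \<and> i \<noteq> j \<and> (i = 0 \<or> j = 0)} \<rparr>"

text \<open>Identifies vertex 0 of the cycle with vertex 0 of T (the centre of a star, an end of a
  path); the other vertices 1, 2, ... of T become k, k + 1, ....\<close>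

definition attach_cycle :: "nat \<Rightarrow> nat pair_pre_digraph \<Rightarrow> nat pair_pre_digraph" where
  "attach_cycle k T = (let f = (\<lambda>i. if i = 0 then 0 else k - 1 + i) in
     \<lparr> pverts = pverts (cycle_graph k) \<union> f ` pverts T,
       parcs = parcs (cycle_graph k) \<union> map_prod f f ` parcs T \<rparr>)"

definition G_star :: "nat \<Rightarrow> nat \<Rightarrow> nat pair_pre_digraph" where
  "G_star k n = attach_cycle k (star_graph (n - k + 1))"

definition G_path :: "nat \<Rightarrow> nat \<Rightarrow> nat pair_pre_digraph" where
  "G_path k n = attach_cycle k (path_graph (n - k + 1))"

text \<open>Here p is the list of vertices of the path from u to w, so its last but one entry is
  the neighbour of w on the path.\<close>

definition ggs_admissible :: "'a pair_pre_digraph \<Rightarrow> 'a \<Rightarrow> 'a \<Rightarrow> 'a list \<Rightarrow> bool" where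
  "ggs_admissible G u w p \<longleftrightarrow>
     u \<noteq> w \<and> vpath p (with_proj G) \<and> hd p = u \<and> last p = w \<and>
     (\<forall>x \<in> set p - {u, w}. graph_degree G x = 2) \<and>
     \<not> (\<exists>c. graph_cycle G c \<and> u \<in> cycle_verts c \<and> w \<in> cycle_verts c)"

definition ggs_shift :: "'a pair_pre_digraph \<Rightarrow> 'a \<Rightarrow> 'a \<Rightarrow> 'a list \<Rightarrow> 'a pair_pre_digraph" where
  "ggs_shift G u w p = (let Z = neighbours G w - {last (butlast p)} in
     \<lparr> pverts = pverts G,
       parcs = (parcs G - ({w} \<times> Z \<union> Z \<times> {w})) \<union> ({u} \<times> Z \<union> Z \<times> {u}) \<rparr>)"

definition ggs_step :: "'a pair_pre_digraph \<Rightarrow> 'a pair_pre_digraph \<Rightarrow> bool" where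
  "ggs_step G H \<longleftrightarrow> (\<exists>u w p. ggs_admissible G u w p \<and> H = ggs_shift G u w p)"

definition ggs_le :: "'a pair_pre_digraph \<Rightarrow> 'a pair_pre_digraph \<Rightarrow> bool" (infix "\<le>\<^sub>G\<^sub>G\<^sub>S" 50) where
  "G \<le>\<^sub>G\<^sub>G\<^sub>S H \<longleftrightarrow> (\<exists>H'. ggs_step\<^sup>*\<^sup>* G H' \<and> graph_iso H' H)"

end

theory Submission
  imports Defs "HOL-Analysis.Function_Topology"
begin

text \<open>
  A graph in \<^term>\<open>Omega k n\<close> is a cycle with a rooted tree hanging from one of its vertices. It is
  described here by the list of its cycle vertices, starting with the root, the set of its
  remaining vertices and a parent function on them (locale \<open>rooted_unicycle\<close>, lemmas
  \<open>unicycle_in_Omega\<close> and \<open>Omega_imp_unicycle\<close>).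

  Only one kind of generalized graph shift is needed: along a path that descends in the tree from
  \<open>u\<close> to \<open>w\<close> without branching in between, all children of \<open>w\<close> are moved to \<open>u\<close>. Such a shift
  does not decrease the spectral radius and does not increase the Wiener index
  (\<open>ggs_improves_lifted\<close>). For the spectral radius, take a nonnegative eigenvector \<open>x\<close> before the
  shift. If \<open>x u \<ge> x w\<close>, then \<open>x\<close> itself has no smaller Rayleigh quotient after the shift.
  Otherwise this holds for \<open>x\<close> reflected along the path: the branch that has arrived at \<open>u\<close> sees
  the old value \<open>x w\<close>, and whatever else hangs at \<open>u\<close> sees \<open>x w\<close> instead of the smaller \<open>x u\<close>. For the
  Wiener index, the distances between the branch and the path are only permuted by the reflection
  of the path, all other distances do not grow.

  Every graph of the class reaches the star by such shifts: as long as some child \<open>w\<close> of the root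
  has children, shift along the edge from the root to \<open>w\<close> (\<open>ggs_improves_star\<close>). Every graph of
  the class is reached from the path, up to isomorphism: number the tree vertices in depth-first
  preorder, so that the path is the graph in which each vertex is the child of its predecessor. In
  any other graph, let \<open>j\<close> be the first vertex that is not a child of \<open>j - 1\<close>. Hanging \<open>j\<close> below
  \<open>j - 1\<close> again gives a preorder numbering, and the shift that moves \<open>j\<close> back is of the required
  kind (\<open>ggs_improves_path\<close>). The two chains of shifts give both the order relations and the
  inequalities.
\<close>

section \<open>The largest eigenvalue of a symmetric matrix\<close>

definition quadratic_form :: "real mat \<Rightarrow> (nat \<Rightarrow> real) \<Rightarrow> real" where
  "quadratic_form A x = (\<Sum>i<dim_row A. \<Sum>j<dim_row A. A $$ (i, j) * x i * x j)"

definition norm_sq :: "nat \<Rightarrow> (nat \<Rightarrow> real) \<Rightarrow> real" where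
  "norm_sq n x = (\<Sum>i<n. (x i)\<^sup>2)"

text \<open>The first-order condition at a minimum, for the perturbation of an extremal vector in one
  coordinate.\<close>

lemma zero_if_parabola_nonneg:
  fixes b c :: real
  assumes "\<And>t. 0 \<le> 2 * t * b + t\<^sup>2 * c"
  shows "b = 0"
proof (rule ccontr)
  assume "b \<noteq> 0"
  \<comment> \<open>At \<open>t = - b / M\<close> with \<open>M > c\<close> the linear term outweighs the quadratic one.\<close>
  define M where "M = \<bar>c\<bar> + 1"
  have "M > 0" "c < M" unfolding M_def by auto
  have "2 * (- b / M) * b + (- b / M)\<^sup>2 * c = b\<^sup>2 / M * (c / M - 2)"
    using \<open>M > 0\<close> by (simp add: power2_eq_square field_simps)
  moreover have "c / M - 2 < 0" using \<open>c < M\<close> \<open>M > 0\<close> by (simp add: field_simps)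
  moreover have "b\<^sup>2 / M > 0" using \<open>b \<noteq> 0\<close> \<open>M > 0\<close> by simp
  ultimately have "2 * (- b / M) * b + (- b / M)\<^sup>2 * c < 0"
    by (metis mult_pos_neg)
  then show False using assms[of "- b / M"] by linarith
qed

lemma continuous_on_quadratic_form: "continuous_on S (quadratic_form A)"
  unfolding quadratic_form_def
  by (intro continuous_intros continuous_on_product_then_coordinatewise continuous_on_id)

lemma continuous_on_norm_sq: "continuous_on S (norm_sq n)"
  unfolding norm_sq_def
  by (intro continuous_intros continuous_on_product_then_coordinatewise continuous_on_id)

text \<open>Vectors of dimension \<open>n\<close> are functions that vanish from \<open>n\<close> on. In the product topology their
  unit sphere is a closed subset of a product of compact sets, so it is compact by Tychonoff's
  theorem.\<close>

lemma compact_unit_sphere: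
  "compact {x :: nat \<Rightarrow> real. (\<forall>i\<ge>n. x i = 0) \<and> norm_sq n x = 1}"
proof -
  let ?B = "\<lambda>i. if i < n then {-1..1} else {0 :: real}"
  have "compactin (product_topology (\<lambda>_ :: nat. euclidean) UNIV) (PiE UNIV ?B)"
    unfolding compactin_PiE by auto
  then have "compact (PiE UNIV ?B)"
    by (simp add: euclidean_product_topology)
  moreover have "closed (norm_sq n -` {1})"
    by (intro closed_vimage continuous_on_norm_sq) simp
  ultimately have "compact (PiE UNIV ?B \<inter> norm_sq n -` {1})"
    by (rule compact_Int_closed)
  moreover have "{x. (\<forall>i\<ge>n. x i = 0) \<and> norm_sq n x = 1} = PiE UNIV ?B \<inter> norm_sq n -` {1}"
  proof -
    have "\<bar>x i\<bar> \<le> 1" if "norm_sq n x = 1" "i < n" for x i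
    proof -
      have "(x i)\<^sup>2 \<le> norm_sq n x"
        unfolding norm_sq_def using that by (intro member_le_sum) auto
      then show ?thesis using that by (simp add: abs_square_le_1)
    qed
    then show ?thesis by (fastforce simp: PiE_def Pi_def abs_le_iff)
  qed
  ultimately show ?thesis by simp
qed

lemma quadratic_form_scale: "quadratic_form A (\<lambda>i. c * x i) = c\<^sup>2 * quadratic_form A x"
  by (simp add: quadratic_form_def sum_distrib_left power2_eq_square ac_simps)

lemma norm_sq_scale: "norm_sq n (\<lambda>i. c * x i) = c\<^sup>2 * norm_sq n x"
  by (simp add: norm_sq_def sum_distrib_left power_mult_distrib)

lemma quadratic_form_cong: "(\<And>i. i < dim_row A \<Longrightarrow> x i = y i) \<Longrightarrow> quadratic_form A x = quadratic_form A y"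
  by (simp add: quadratic_form_def)

lemma norm_sq_cong: "(\<And>i. i < n \<Longrightarrow> x i = y i) \<Longrightarrow> norm_sq n x = norm_sq n y"
  by (simp add: norm_sq_def)

lemma norm_sq_nonneg: "norm_sq n x \<ge> 0"
  by (simp add: norm_sq_def sum_nonneg)

lemma norm_sq_eq_0_iff: "norm_sq n x = 0 \<longleftrightarrow> (\<forall>i<n. x i = 0)"
  by (auto simp: norm_sq_def sum_nonneg_eq_0_iff)

lemma quadratic_form_perturb:
  assumes A: "A \<in> carrier_mat n n" and sym: "\<And>i j. i < n \<Longrightarrow> j < n \<Longrightarrow> A $$ (i, j) = A $$ (j, i)"
    and "k < n"
  shows "quadratic_form A (\<lambda>i. x i + (if i = k then t else 0))
    = quadratic_form A x + 2 * t * (\<Sum>j<n. A $$ (k, j) * x j) + t\<^sup>2 * A $$ (k, k)"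
proof -
  let ?e = "\<lambda>i. if i = k then t else (0 :: real)"
  have "quadratic_form A (\<lambda>i. x i + ?e i) = (\<Sum>i<n. \<Sum>j<n. A $$ (i, j) * x i * x j)
     + (\<Sum>i<n. \<Sum>j<n. A $$ (i, j) * x i * ?e j) + (\<Sum>i<n. \<Sum>j<n. A $$ (i, j) * ?e i * x j)
     + (\<Sum>i<n. \<Sum>j<n. A $$ (i, j) * ?e i * ?e j)"
    using A unfolding quadratic_form_def sum.distrib[symmetric]
    by (intro sum.cong) (auto simp: algebra_simps)
  also have "(\<Sum>i<n. \<Sum>j<n. A $$ (i, j) * x i * x j) = quadratic_form A x"
    using A by (simp add: quadratic_form_def)
  also have "(\<Sum>i<n. \<Sum>j<n. A $$ (i, j) * x i * ?e j) = (\<Sum>i<n. A $$ (i, k) * x i * t)"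
    using \<open>k < n\<close> by (intro sum.cong) (auto simp: if_distrib cong: if_cong)
  also have "\<dots> = t * (\<Sum>j<n. A $$ (k, j) * x j)"
    using sym \<open>k < n\<close> by (auto simp: sum_distrib_left intro!: sum.cong)
  also have "(\<Sum>i<n. \<Sum>j<n. A $$ (i, j) * ?e i * x j) = (\<Sum>j<n. \<Sum>i<n. A $$ (i, j) * ?e i * x j)"
    by (rule sum.swap)
  also have "\<dots> = (\<Sum>j<n. A $$ (k, j) * t * x j)"
    using \<open>k < n\<close> by (intro sum.cong) (auto simp: if_distrib if_distribR cong: if_cong)
  also have "\<dots> = t * (\<Sum>j<n. A $$ (k, j) * x j)"
    by (auto simp: sum_distrib_left intro!: sum.cong)
  also have "(\<Sum>i<n. \<Sum>j<n. A $$ (i, j) * ?e i * ?e j) = (\<Sum>i<n. A $$ (i, k) * ?e i * t)"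
    using \<open>k < n\<close> by (intro sum.cong) (auto simp: if_distrib cong: if_cong)
  also have "\<dots> = t\<^sup>2 * A $$ (k, k)"
    using \<open>k < n\<close> by (auto simp: if_distrib if_distribR power2_eq_square cong: if_cong)
  finally show ?thesis by simp
qed

lemma norm_sq_perturb:
  assumes "k < n"
  shows "norm_sq n (\<lambda>i. x i + (if i = k then t else 0)) = norm_sq n x + 2 * t * x k + t\<^sup>2"
proof -
  have "norm_sq n (\<lambda>i. x i + (if i = k then t else 0))
      = (\<Sum>i<n. (x i)\<^sup>2 + (if i = k then 2 * t * x k + t\<^sup>2 else 0))"
    unfolding norm_sq_def by (intro sum.cong) (auto simp: power2_sum)
  then show ?thesis using assms by (simp add: sum.distrib norm_sq_def)
qed

lemma quadratic_form_eigenvector: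
  assumes A: "A \<in> carrier_mat n n" and ev: "eigenvector A v c"
  shows "quadratic_form A (($) v) = c * norm_sq n (($) v)" "norm_sq n (($) v) > 0"
proof -
  from A ev have v: "v \<in> carrier_vec n" "v \<noteq> 0\<^sub>v n" "A *\<^sub>v v = c \<cdot>\<^sub>v v"
    by (auto simp: eigenvector_def)
  have row: "(\<Sum>j<n. A $$ (i, j) * v $ j) = c * v $ i" if "i < n" for i
  proof -
    have "(A *\<^sub>v v) $ i = (\<Sum>j<n. A $$ (i, j) * v $ j)"
      using that A v(1) by (auto simp: scalar_prod_def lessThan_atLeast0 intro!: sum.cong)
    then show ?thesis using v that by simp
  qed
  have "quadratic_form A (($) v) = (\<Sum>i<n. v $ i * (\<Sum>j<n. A $$ (i, j) * v $ j))"
    using A by (simp add: quadratic_form_def sum_distrib_left ac_simps)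
  also have "\<dots> = (\<Sum>i<n. c * (v $ i)\<^sup>2)"
    using row by (intro sum.cong) (auto simp: power2_eq_square)
  finally show "quadratic_form A (($) v) = c * norm_sq n (($) v)"
    by (simp add: norm_sq_def sum_distrib_left)
  have "norm_sq n (($) v) \<noteq> 0"
    using v(1,2) by (auto simp: norm_sq_eq_0_iff)
  then show "norm_sq n (($) v) > 0"
    using norm_sq_nonneg[of n "($) v"] by linarith
qed

text \<open>The quadratic form attains its maximum \<open>c\<close> on the unit sphere at some \<open>x\<close>. By homogeneity
  \<open>c * norm_sq n y - quadratic_form A y\<close> is nonnegative for all \<open>y\<close> and zero at \<open>x\<close>. Along each
  coordinate direction this is a parabola, and the vanishing of its linear coefficient is one row
  of the equation \<open>A x = c x\<close>.\<close>

lemma symmetric_mat_top_eigenvalue: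
  fixes A :: "real mat"
  assumes A: "A \<in> carrier_mat n n" and sym: "\<And>i j. i < n \<Longrightarrow> j < n \<Longrightarrow> A $$ (i, j) = A $$ (j, i)"
    and "n > 0"
  obtains c where "eigenvalue A c" "\<And>x. quadratic_form A x \<le> c * norm_sq n x"
proof -
  define S where "S = {x :: nat \<Rightarrow> real. (\<forall>i\<ge>n. x i = 0) \<and> norm_sq n x = 1}"
  have "norm_sq n (\<lambda>i. if i = 0 then 1 else 0) = (\<Sum>i<n. if i = 0 then 1 else 0)"
    unfolding norm_sq_def by (intro sum.cong) auto
  then have "(\<lambda>i. if i = 0 then 1 else 0) \<in> S"
    using \<open>n > 0\<close> by (auto simp: S_def)
  then have "S \<noteq> {}" by blast
  moreover have "compact S" unfolding S_def by (rule compact_unit_sphere)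
  ultimately obtain x where "x \<in> S"
      and max: "\<And>y. y \<in> S \<Longrightarrow> quadratic_form A y \<le> quadratic_form A x"
    using continuous_attains_sup[OF _ _ continuous_on_quadratic_form] by metis
  then have x: "norm_sq n x = 1" by (simp add: S_def)
  define c where "c = quadratic_form A x"
  have bound: "quadratic_form A y \<le> c * norm_sq n y" for y
  proof (cases "norm_sq n y = 0")
    case True
    then have "quadratic_form A y = quadratic_form A (\<lambda>i. 0)"
      using A by (intro quadratic_form_cong) (auto simp: norm_sq_eq_0_iff)
    then show ?thesis using True by (simp add: quadratic_form_def)
  next
    case False
    define s where "s = sqrt (norm_sq n y)"
    have s: "s\<^sup>2 = norm_sq n y" "s \<noteq> 0"
      using False norm_sq_nonneg[of n y] by (auto simp: s_def)
    let ?z = "\<lambda>i. (1 / s) * (if i < n then y i else 0)"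
    have "norm_sq n ?z = (1 / s)\<^sup>2 * norm_sq n (\<lambda>i. if i < n then y i else 0)"
      by (rule norm_sq_scale)
    also have "norm_sq n (\<lambda>i. if i < n then y i else 0) = norm_sq n y"
      by (rule norm_sq_cong) auto
    finally have "?z \<in> S" using s by (auto simp: S_def power_divide)
    then have "quadratic_form A ?z \<le> c" unfolding c_def by (rule max)
    moreover have "quadratic_form A ?z = (1 / s)\<^sup>2 * quadratic_form A (\<lambda>i. if i < n then y i else 0)"
      by (rule quadratic_form_scale)
    moreover have "quadratic_form A (\<lambda>i. if i < n then y i else 0) = quadratic_form A y"
      using A by (intro quadratic_form_cong) auto
    ultimately have "quadratic_form A y / s\<^sup>2 \<le> c" by (simp add: power_divide)
    moreover have "s\<^sup>2 > 0" using s(2) by simp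
    ultimately have "quadratic_form A y \<le> c * s\<^sup>2" by (simp add: pos_divide_le_eq)
    then show ?thesis by (simp only: s(1))
  qed
  have row: "(\<Sum>j<n. A $$ (k, j) * x j) = c * x k" if "k < n" for k
  proof -
    have "0 \<le> 2 * t * (c * x k - (\<Sum>j<n. A $$ (k, j) * x j)) + t\<^sup>2 * (c - A $$ (k, k))" for t
    proof -
      have "quadratic_form A (\<lambda>i. x i + (if i = k then t else 0))
          = quadratic_form A x + 2 * t * (\<Sum>j<n. A $$ (k, j) * x j) + t\<^sup>2 * A $$ (k, k)"
        by (rule quadratic_form_perturb[OF A _ that]) (rule sym)
      moreover have "norm_sq n (\<lambda>i. x i + (if i = k then t else 0)) = 1 + 2 * t * x k + t\<^sup>2"
        using norm_sq_perturb[OF that] x by simp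
      ultimately show ?thesis
        using bound[of "\<lambda>i. x i + (if i = k then t else 0)"]
        by (simp add: algebra_simps c_def)
    qed
    from zero_if_parabola_nonneg[OF this] show ?thesis by simp
  qed
  have "eigenvector A (vec n x) c"
    unfolding eigenvector_def
  proof (intro conjI)
    show "vec n x \<in> carrier_vec (dim_row A)" using A by auto
    have "\<not> (\<forall>i<n. x i = 0)" using x norm_sq_eq_0_iff[of n x] by auto
    then show "vec n x \<noteq> 0\<^sub>v (dim_row A)"
      using A by (metis carrier_matD(1) index_vec index_zero_vec(1))
    show "A *\<^sub>v vec n x = c \<cdot>\<^sub>v vec n x"
      using A row by (auto simp: scalar_prod_def lessThan_atLeast0 intro!: eq_vecI)
  qed
  then have "eigenvalue A c" by (auto simp: eigenvalue_def)
  then show ?thesis using bound that by blast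
qed

text \<open>An eigenvector for an eigenvalue \<open>c'\<close> has Rayleigh quotient \<open>c'\<close>, so no eigenvalue exceeds the
  maximal Rayleigh quotient, which is itself an eigenvalue.\<close>

lemma symmetric_mat_Max_spectrum:
  fixes A :: "real mat"
  assumes A: "A \<in> carrier_mat n n" and sym: "\<And>i j. i < n \<Longrightarrow> j < n \<Longrightarrow> A $$ (i, j) = A $$ (j, i)"
    and "n > 0"
  shows "eigenvalue A (Max (spectrum A))"
    and "quadratic_form A x \<le> Max (spectrum A) * norm_sq n x"
proof -
  obtain c where c: "eigenvalue A c" "\<And>x. quadratic_form A x \<le> c * norm_sq n x"
    using symmetric_mat_top_eigenvalue[OF assms] by blast
  have "c' \<le> c" if ev: "eigenvalue A c'" for c'
  proof -
    obtain v where "eigenvector A v c'" using ev by (auto simp: eigenvalue_def)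
    from quadratic_form_eigenvector[OF A this] c(2)[of "($) v"] show ?thesis by simp
  qed
  then have "Max (spectrum A) = c"
    using c(1) card_finite_spectrum(1)[OF A] by (intro Max_eqI) (auto simp: spectrum_def)
  then show "eigenvalue A (Max (spectrum A))"
    and "quadratic_form A x \<le> Max (spectrum A) * norm_sq n x"
    using c by auto
qed

section \<open>The spectral radius of a graph\<close>

definition arc_form :: "('a \<times> 'a) set \<Rightarrow> ('a \<Rightarrow> real) \<Rightarrow> real" where
  "arc_form E x = (\<Sum>(i, j)\<in>E. x i * x j)"

context
  fixes G :: "nat pair_pre_digraph" and n :: nat
  assumes verts: "pverts G = {..<n}" and arcs: "parcs G \<subseteq> {..<n} \<times> {..<n}"
    and sym: "sym (parcs G)" and pos: "n > 0"
begin

lemma quadratic_form_adj_matrix: "quadratic_form (adj_matrix G) x = arc_form (parcs G) x"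
proof -
  have dim: "dim_row (adj_matrix G) = n" by (simp add: adj_matrix_def verts)
  have "adj_matrix G $$ (i, j) * x i * x j = (if (i, j) \<in> parcs G then x i * x j else 0)"
    if "i < n" "j < n" for i j
    using that by (simp add: adj_matrix_def verts)
  then have "quadratic_form (adj_matrix G) x
      = (\<Sum>i<n. \<Sum>j<n. if (i, j) \<in> parcs G then x i * x j else 0)"
    unfolding quadratic_form_def dim by simp
  also have "\<dots> = (\<Sum>p\<in>{..<n} \<times> {..<n}. if p \<in> parcs G then x (fst p) * x (snd p) else 0)"
    by (subst sum.cartesian_product) (auto intro!: sum.cong)
  also have "\<dots> = (\<Sum>p\<in>({..<n} \<times> {..<n}) \<inter> parcs G. x (fst p) * x (snd p))"
    by (simp add: sum.inter_restrict)
  also have "({..<n} \<times> {..<n}) \<inter> parcs G = parcs G" using arcs by blast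
  finally show ?thesis by (simp add: arc_form_def case_prod_unfold)
qed

lemma adj_matrix_symmetric:
  "adj_matrix G \<in> carrier_mat n n"
  "i < n \<Longrightarrow> j < n \<Longrightarrow> adj_matrix G $$ (i, j) = adj_matrix G $$ (j, i)"
  using verts sym by (auto simp: adj_matrix_def dest: symD)

lemma arc_form_le_adj_sigma: "arc_form (parcs G) x \<le> adj_sigma G * norm_sq n x"
  using symmetric_mat_Max_spectrum(2)[OF adj_matrix_symmetric pos]
  by (simp add: quadratic_form_adj_matrix adj_sigma_def)

text \<open>Replacing an eigenvector by its absolute values keeps the norm and can only increase the sum
  over the arcs, so an extremal vector can be taken nonnegative.\<close>

lemma adj_sigma_attained:
  obtains x where "\<And>i. x i \<ge> 0" "norm_sq n x > 0" "adj_sigma G * norm_sq n x \<le> arc_form (parcs G) x"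
proof -
  obtain v where v: "eigenvector (adj_matrix G) v (adj_sigma G)"
    using symmetric_mat_Max_spectrum(1)[OF adj_matrix_symmetric pos]
    by (auto simp: adj_sigma_def eigenvalue_def)
  note * = quadratic_form_eigenvector[OF adj_matrix_symmetric(1) v]
  let ?x = "\<lambda>i. \<bar>v $ i\<bar>"
  have norm: "norm_sq n ?x = norm_sq n (($) v)" by (simp add: norm_sq_def)
  have "adj_sigma G * norm_sq n (($) v) = arc_form (parcs G) (($) v)"
    using *(1) by (simp add: quadratic_form_adj_matrix)
  also have "\<dots> \<le> arc_form (parcs G) ?x"
    unfolding arc_form_def by (intro sum_mono) (auto simp flip: abs_mult)
  finally show ?thesis using that[of ?x] *(2) norm by simp
qed

end

text \<open>Spectral radii are compared by turning an extremal vector of one graph into a test vector of the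
  other.\<close>

lemma adj_sigma_mono:
  assumes G: "pverts G = {..<n}" "parcs G \<subseteq> {..<n} \<times> {..<n}" "sym (parcs G)"
    and H: "pverts H = {..<n}" "parcs H \<subseteq> {..<n} \<times> {..<n}" "sym (parcs H)"
    and "n > 0"
    and "\<And>x. (\<And>i. x i \<ge> 0) \<Longrightarrow>
      \<exists>y. norm_sq n y = norm_sq n x \<and> arc_form (parcs G) x \<le> arc_form (parcs H) y"
  shows "adj_sigma G \<le> adj_sigma H"
proof -
  obtain x where x: "\<And>i. x i \<ge> 0" "norm_sq n x > 0"
      "adj_sigma G * norm_sq n x \<le> arc_form (parcs G) x"
    using adj_sigma_attained[OF G \<open>n > 0\<close>] by blast
  then obtain y where "norm_sq n y = norm_sq n x" "arc_form (parcs G) x \<le> arc_form (parcs H) y"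
    using assms(8) by blast
  then have "adj_sigma G * norm_sq n x \<le> adj_sigma H * norm_sq n x"
    using x(3) arc_form_le_adj_sigma[OF H \<open>n > 0\<close>, of y] by simp
  then show ?thesis using x(2) by simp
qed

section \<open>Walks, cycles and isomorphisms of graphs\<close>

text \<open>The arcs traversed by the closed walk that visits the entries of the list in order and then
  returns to the first entry.\<close>

definition closed_arcs :: "'a list \<Rightarrow> ('a \<times> 'a) set" where
  "closed_arcs xs = set (zip xs (rotate1 xs))"

lemma closed_arcs_nth: "closed_arcs xs = {(xs ! i, xs ! (Suc i mod length xs)) |i. i < length xs}"
proof -
  have "closed_arcs xs = (\<lambda>i. (xs ! i, rotate1 xs ! i)) ` {..<length xs}"
    by (auto simp: closed_arcs_def set_zip)
  also have "\<dots> = (\<lambda>i. (xs ! i, xs ! (Suc i mod length xs))) ` {..<length xs}"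
    by (intro image_cong) (auto simp: nth_rotate1)
  finally show ?thesis by auto
qed

lemma zip_rotate1:
  assumes "length xs = length ys"
  shows "zip (rotate1 xs) (rotate1 ys) = rotate1 (zip xs ys)"
  using assms by (cases xs; cases ys) auto

lemma closed_arcs_rotate: "closed_arcs (rotate m xs) = closed_arcs xs"
proof (induction m)
  case (Suc m)
  have "zip (rotate1 (rotate m xs)) (rotate1 (rotate1 (rotate m xs)))
      = rotate1 (zip (rotate m xs) (rotate1 (rotate m xs)))"
    by (rule zip_rotate1) simp
  then have "closed_arcs (rotate1 (rotate m xs)) = closed_arcs (rotate m xs)"
    by (simp add: closed_arcs_def)
  with Suc show ?case by simp
qed simp

lemma closed_arcs_map: "closed_arcs (map f xs) = map_prod f f ` closed_arcs xs"
  by (simp add: closed_arcs_def rotate1_map zip_map_map map_prod_def)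

lemma closed_arcs_subset: "closed_arcs xs \<subseteq> set xs \<times> set xs"
  by (auto simp: closed_arcs_def dest: set_zip_leftD set_zip_rightD)

lemma pcas_iff: "pcas u c v \<longleftrightarrow> map fst c @ [v] = u # map snd c"
proof (induction c arbitrary: u)
  case (Cons e c)
  then show ?case by (cases c) auto
qed auto

lemma pawalk_verts_eq: "pcas u c v \<Longrightarrow> pawalk_verts u c = u # map snd c"
  by (induction c arbitrary: u) auto

text \<open>A closed walk is determined by the start vertices of its arcs: its end vertices are the same list,
  rotated by one. Cycles are from here on represented by these vertex lists.\<close>

lemma graph_cycle_iff:
  assumes "pair_wf_digraph G"
  shows "graph_cycle G c \<longleftrightarrow>
    (\<exists>xs. c = zip xs (rotate1 xs) \<and> distinct xs \<and> 3 \<le> length xs \<and> closed_arcs xs \<subseteq> parcs G)"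
    (is "?L \<longleftrightarrow> ?R")
proof -
  interpret pair_wf_digraph G by fact
  show ?thesis
  proof
    assume ?L
    then obtain u where u: "set c \<subseteq> parcs G" "pcas u c u" "distinct (tl (pawalk_verts u c))"
      and len: "3 \<le> length c"
      by (auto simp: graph_cycle_def cycle_def awalk_def)
    have walk: "map fst c @ [u] = u # map snd c" using u(2) by (simp add: pcas_iff)
    then have "map snd c = rotate1 (map fst c)" using len by (cases c) auto
    then have "c = zip (map fst c) (rotate1 (map fst c))"
      by (metis zip_map_fst_snd)
    moreover have "distinct (map fst c)"
      using u \<open>map snd c = _\<close> by (simp add: pawalk_verts_eq)
    ultimately show ?R using u(1) len
      by (intro exI[of _ "map fst c"]) (auto simp: closed_arcs_def)
  next
    assume ?R
    then obtain xs where xs: "c = zip xs (rotate1 xs)" "distinct xs" "3 \<le> length xs"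
      "closed_arcs xs \<subseteq> parcs G" by blast
    obtain u ys where u: "xs = u # ys" using xs(3) by (cases xs) auto
    have cas: "pcas u c u" unfolding pcas_iff xs(1) by (simp add: u)
    have "u \<in> pverts G"
      using xs(4) in_arcsD1 by (cases ys) (auto simp: u closed_arcs_def)
    moreover have "map snd c = rotate1 xs" by (simp add: xs(1))
    ultimately show ?L
      using cas xs
      by (auto simp: graph_cycle_def cycle_def awalk_def pawalk_verts_eq closed_arcs_def
          intro!: exI[of _ u])
  qed
qed

lemma cycle_verts_zip: "cycle_verts (zip xs (rotate1 xs)) = set xs"
proof -
  have "cycle_verts (zip xs (rotate1 xs)) = set (map fst (zip xs (rotate1 xs)))"
    by (simp only: cycle_verts_def set_map)
  also have "map fst (zip xs (rotate1 xs)) = xs" by simp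
  finally show ?thesis .
qed

lemma cycle_edges_zip: "cycle_edges (zip xs (rotate1 xs)) = (\<lambda>(x, y). {x, y}) ` closed_arcs xs"
  by (simp add: cycle_edges_def closed_arcs_def)

lemma graph_degree_eq_card: "graph_degree G v = card (neighbours G v)"
proof -
  have "out_arcs (with_proj G) v = Pair v ` neighbours G v"
    by (auto simp: out_arcs_def neighbours_def)
  then show ?thesis
    by (simp add: graph_degree_def out_degree_def card_image inj_on_def)
qed

lemma connected_iff_rtrancl:
  assumes "pair_wf_digraph G" and "sym (parcs G)"
  shows "Digraph_Component.connected (with_proj G) \<longleftrightarrow>
    pverts G \<noteq> {} \<and> (\<forall>u\<in>pverts G. \<forall>v\<in>pverts G. (u, v) \<in> (parcs G)\<^sup>*)"
proof -
  interpret pair_wf_digraph G by fact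
  have "symmetric (with_proj G)" using assms(2) by (simp add: symmetric_def)
  then have "parcs (mk_symmetric (with_proj G)) = parcs G" by (rule adj_mk_symmetric_eq)
  moreover have "(u, v) \<in> rtrancl_on (pverts G) (parcs G) \<longleftrightarrow> (u, v) \<in> (parcs G)\<^sup>*"
    if "u \<in> pverts G" "v \<in> pverts G" for u v
    using that rtrancl_consistent_rtrancl_on[of u v "parcs G" "pverts G"] rtrancl_on_rtranclI
      in_arcsD2 by metis
  ultimately show ?thesis
    by (auto simp: Digraph_Component.connected_def strongly_connected_def reachable_def)
qed

text \<open>When the next vertex is already on the path, the path is cut back to it.\<close>

lemma rtrancl_imp_simple_path:
  assumes "(x, y) \<in> R\<^sup>*"
  obtains xs where "xs \<noteq> []" "distinct xs" "hd xs = x" "last xs = y"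
    "successively (\<lambda>a b. (a, b) \<in> R) xs"
  using assms
proof (induction arbitrary: thesis rule: rtrancl_induct)
  case base
  show ?case by (rule base[of "[x]"]) auto
next
  case (step y z)
  obtain xs where xs: "xs \<noteq> []" "distinct xs" "hd xs = x" "last xs = y"
    "successively (\<lambda>a b. (a, b) \<in> R) xs" using step.IH by blast
  show ?case
  proof (cases "z \<in> set xs")
    case True
    then obtain ys zs where split: "xs = (ys @ [z]) @ zs" by (metis append.assoc append_Cons append_Nil split_list)
    show ?thesis
      using xs unfolding split
      by (intro step.prems[of "ys @ [z]"]) (auto simp: successively_append_iff hd_append split: if_splits)
  next
    case False
    show ?thesis
      using xs False step.hyps
      by (intro step.prems[of "xs @ [z]"]) (auto simp: successively_append_iff)
  qed
qed

lemma closed_arcs_successively: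
  assumes "successively (\<lambda>a b. (a, b) \<in> R) xs" "xs \<noteq> []"
  shows "closed_arcs xs \<subseteq> R \<union> {(last xs, hd xs)}"
proof -
  have "(xs ! i, xs ! (Suc i mod length xs)) \<in> R \<union> {(last xs, hd xs)}" if "i < length xs" for i
  proof (cases "Suc i = length xs")
    case True
    then have "xs ! i = last xs" "xs ! (Suc i mod length xs) = hd xs"
      using assms(2) by (auto simp: last_conv_nth hd_conv_nth simp flip: True)
    then show ?thesis by simp
  next
    case False
    then show ?thesis using that assms(1) by (auto simp: successively_conv_nth)
  qed
  then show ?thesis by (auto simp: closed_arcs_nth)
qed

text \<open>A simple path from \<open>x\<close> to \<open>y\<close> inside \<open>R\<close> has at least two arcs, because the arc from \<open>x\<close> to \<open>y\<close> is
  missing from \<open>R\<close>; the arc back from \<open>y\<close> to \<open>x\<close> closes it to a cycle of length at least three.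
  Applied to a spanning subgraph, this shows that a unicyclic graph has no further edges.\<close>

lemma cycle_through_new_edge:
  assumes wf: "pair_wf_digraph G" and "R \<subseteq> parcs G" "(x, y) \<in> R\<^sup>*" "(x, y) \<notin> R" "x \<noteq> y"
    "(y, x) \<in> parcs G"
  obtains c where "graph_cycle G c" "{x, y} \<in> cycle_edges c"
proof -
  obtain xs where xs: "xs \<noteq> []" "distinct xs" "hd xs = x" "last xs = y"
    "successively (\<lambda>a b. (a, b) \<in> R) xs"
    using rtrancl_imp_simple_path[OF assms(3)] by blast
  have "3 \<le> length xs"
  proof -
    obtain zs where zs: "xs = x # zs" using xs(1,3) by (cases xs) auto
    obtain b ws where bs: "zs = b # ws" using zs xs(4) \<open>x \<noteq> y\<close> by (cases zs) auto
    have "ws \<noteq> []" using zs bs xs(4,5) assms(4) by auto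
    then show ?thesis by (cases ws) (auto simp: zs bs)
  qed
  have "closed_arcs xs \<subseteq> parcs G"
    using closed_arcs_successively[OF xs(5,1)] xs(3,4) assms(2,6) by auto
  then have "graph_cycle G (zip xs (rotate1 xs))"
    using graph_cycle_iff[OF wf] xs \<open>3 \<le> length xs\<close> by blast
  moreover have "(last xs, hd xs) \<in> closed_arcs xs"
    using xs(1) unfolding closed_arcs_nth
    by (auto simp: last_conv_nth hd_conv_nth intro!: exI[of _ "length xs - 1"])
  then have "{x, y} \<in> cycle_edges (zip xs (rotate1 xs))"
    unfolding cycle_edges_zip xs(3,4) by force
  ultimately show ?thesis using that by blast
qed

lemma pcas_hom:
  assumes "pcas u p v" "set p \<subseteq> E"
    and hom: "\<And>x y. (x, y) \<in> E \<Longrightarrow> f x = f y \<or> (f x, f y) \<in> E'"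
  shows "\<exists>p'. pcas (f u) p' (f v) \<and> set p' \<subseteq> E' \<and> length p' \<le> length p"
  using assms(1,2)
proof (induction p arbitrary: u)
  case Nil
  then show ?case by (intro exI[of _ "[]"]) auto
next
  case (Cons e p)
  then have "pcas (snd e) p v" "set p \<subseteq> E" by auto
  from Cons.IH[OF this] obtain p' where
    p': "pcas (f (snd e)) p' (f v)" "set p' \<subseteq> E'" "length p' \<le> length p" by blast
  have e: "fst e = u" "(u, snd e) \<in> E" using Cons.prems by auto
  from hom[OF e(2)] show ?case
  proof
    assume "f u = f (snd e)"
    then show ?thesis using p' by (intro exI[of _ p']) auto
  next
    assume "(f u, f (snd e)) \<in> E'"
    then show ?thesis using p' by (intro exI[of _ "(f u, f (snd e)) # p'"]) auto
  qed
qed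

text \<open>A map that sends every arc to an arc or collapses it to a vertex turns a walk into a walk that is
  not longer. All comparisons of distances below are instances.\<close>

lemma graph_dist_hom_le:
  assumes G: "pair_wf_digraph G" and H: "pair_wf_digraph H"
    and V: "\<And>x. x \<in> pverts G \<Longrightarrow> f x \<in> pverts H"
    and hom: "\<And>x y. (x, y) \<in> parcs G \<Longrightarrow> f x = f y \<or> (f x, f y) \<in> parcs H"
  shows "graph_dist H (f x) (f y) \<le> graph_dist G x y"
proof -
  interpret G: pair_wf_digraph G by fact
  interpret H: pair_wf_digraph H by fact
  have cost: "G.awalk_cost (\<lambda>_. 1) p = length p" "H.awalk_cost (\<lambda>_. 1) q = length q" for p q
    by (simp_all add: G.awalk_cost_def H.awalk_cost_def sum_list_triv)
  have "\<exists>p'\<in>{p. H.awalk (f x) p (f y)}. ereal (length p') \<le> ereal (length p)"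
    if "p \<in> {p. G.awalk x p y}" for p
  proof -
    from that have "x \<in> pverts G" "set p \<subseteq> parcs G" "pcas x p y" by (auto simp: G.awalk_def)
    moreover have "\<exists>p'. pcas (f x) p' (f y) \<and> set p' \<subseteq> parcs H \<and> length p' \<le> length p"
      by (rule pcas_hom[where E = "parcs G"]) (use calculation hom in auto)
    ultimately show ?thesis using V by (auto simp: H.awalk_def)
  qed
  then show ?thesis
    unfolding graph_dist_def G.\<mu>_def H.\<mu>_def cost by (intro INF_mono) auto
qed

definition relabel :: "('a \<Rightarrow> 'b) \<Rightarrow> 'a pair_pre_digraph \<Rightarrow> 'b pair_pre_digraph" where
  "relabel f G = \<lparr>pverts = f ` pverts G, parcs = map_prod f f ` parcs G\<rparr>"

lemma relabel_simps [simp]: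
  "pverts (relabel f G) = f ` pverts G" "parcs (relabel f G) = map_prod f f ` parcs G"
  by (simp_all add: relabel_def)

lemma relabel_wf: "pair_wf_digraph G \<Longrightarrow> pair_wf_digraph (relabel f G)"
  by (auto simp: pair_wf_digraph_def)

lemma relabel_the_inv_into:
  assumes "pair_wf_digraph G" "inj_on f (pverts G)"
  shows "relabel (the_inv_into (pverts G) f) (relabel f G) = G"
proof -
  interpret pair_wf_digraph G by fact
  let ?g = "the_inv_into (pverts G) f"
  have *: "?g (f x) = x" if "x \<in> pverts G" for x
    using that assms(2) by (rule the_inv_into_f_f[rotated])
  have "?g ` f ` pverts G = pverts G" using * by (auto simp: image_image)
  moreover have "map_prod ?g ?g ` map_prod f f ` parcs G = id ` parcs G"
    unfolding image_image
    using in_arcsD1 in_arcsD2 by (intro image_cong) (auto simp: *)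
  ultimately show ?thesis by (simp add: relabel_def)
qed

lemma graph_iso_relabel:
  assumes "pair_wf_digraph G" "inj_on f (pverts G)"
  shows "graph_iso G (relabel f G)"
proof -
  interpret pair_wf_digraph G by fact
  let ?h = "\<lparr>iso_verts = f, iso_arcs = map_prod f f, iso_head = snd, iso_tail = fst\<rparr>"
  have "inj_on (map_prod f f) (parcs G)"
    by (rule inj_on_subset[OF map_prod_inj_on[OF assms(2) assms(2)]])
       (auto dest: in_arcsD1 in_arcsD2)
  then have "pre_digraph.digraph_isomorphism (with_proj G) ?h"
    using assms wf_digraph_wp_iff by (auto simp: pre_digraph.digraph_isomorphism_def)
  moreover have "with_proj (relabel f G) = app_iso ?h (with_proj G)"
    by (simp add: with_proj_def app_iso_def)
  ultimately show ?thesis by (auto simp: graph_iso_def digraph_iso_def)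
qed

lemma wiener_relabel_le:
  assumes "pair_wf_digraph G" "inj_on f (pverts G)"
  shows "wiener (relabel f G) \<le> wiener G"
proof -
  have "graph_dist (relabel f G) (f i) (f j) \<le> graph_dist G i j" for i j
    using assms(1) by (intro graph_dist_hom_le relabel_wf) auto
  then show ?thesis
    using assms(2) by (simp add: wiener_def sum.reindex sum_mono)
qed

lemma wiener_relabel:
  assumes "pair_wf_digraph G" "inj_on f (pverts G)"
  shows "wiener (relabel f G) = wiener G"
proof (rule antisym)
  let ?g = "the_inv_into (pverts G) f"
  have "wiener (relabel ?g (relabel f G)) \<le> wiener (relabel f G)"
    using assms by (intro wiener_relabel_le relabel_wf) (auto simp: inj_on_the_inv_into)
  then show "wiener G \<le> wiener (relabel f G)" by (simp add: relabel_the_inv_into assms)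
qed (rule wiener_relabel_le[OF assms])

lemma adj_sigma_relabel_le:
  assumes G: "pverts G = {..<n}" "parcs G \<subseteq> {..<n} \<times> {..<n}" "sym (parcs G)"
    and f: "bij_betw f {..<n} {..<n}" and "n > 0"
  shows "adj_sigma (relabel f G) \<le> adj_sigma G"
proof (rule adj_sigma_mono[where n = n])
  show "pverts (relabel f G) = {..<n}" using f G(1) by (simp add: bij_betw_def)
  show "parcs (relabel f G) \<subseteq> {..<n} \<times> {..<n}" using f G(2) by (force simp: bij_betw_def)
  show "sym (parcs (relabel f G))"
    using G(3) by (force simp: sym_def)
  fix x :: "nat \<Rightarrow> real"
  have inj: "inj_on (map_prod f f) (parcs G)"
    using f G(2) by (auto simp: bij_betw_def intro: inj_on_subset[OF map_prod_inj_on])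
  have "arc_form (parcs (relabel f G)) x = arc_form (parcs G) (x \<circ> f)"
    by (simp add: arc_form_def sum.reindex[OF inj] case_prod_unfold)
  moreover have "norm_sq n (x \<circ> f) = norm_sq n x"
    using sum.reindex_bij_betw[OF f, of "\<lambda>i. (x i)\<^sup>2"] by (simp add: norm_sq_def)
  ultimately show "\<exists>y. norm_sq n y = norm_sq n x \<and>
      arc_form (parcs (relabel f G)) x \<le> arc_form (parcs G) y"
    by (metis order_refl)
qed (use assms in auto)

lemma adj_sigma_relabel:
  assumes G: "pverts G = {..<n}" "parcs G \<subseteq> {..<n} \<times> {..<n}" "sym (parcs G)"
    and f: "bij_betw f {..<n} {..<n}" and "n > 0"
  shows "adj_sigma (relabel f G) = adj_sigma G"
proof (rule antisym)
  let ?g = "the_inv_into (pverts G) f"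
  have wf: "pair_wf_digraph G" using G by (auto simp: pair_wf_digraph_def)
  have "adj_sigma (relabel ?g (relabel f G)) \<le> adj_sigma (relabel f G)"
  proof (rule adj_sigma_relabel_le[where n = n])
    show "pverts (relabel f G) = {..<n}" using f G(1) by (simp add: bij_betw_def)
    show "parcs (relabel f G) \<subseteq> {..<n} \<times> {..<n}" using f G(2) by (force simp: bij_betw_def)
    show "sym (parcs (relabel f G))" using G(3) by (force simp: sym_def)
    show "bij_betw ?g {..<n} {..<n}" using bij_betw_the_inv_into[OF f] G(1) by simp
  qed fact
  moreover have "relabel ?g (relabel f G) = G"
    by (rule relabel_the_inv_into[OF wf]) (use f G(1) in \<open>simp add: bij_betw_def\<close>)
  ultimately show "adj_sigma G \<le> adj_sigma (relabel f G)" by simp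
qed (rule adj_sigma_relabel_le[OF assms])

section \<open>Moving a branch along a path\<close>

lemma set_vwalk_arcs_subset_iff:
  "set (vwalk_arcs xs) \<subseteq> R \<longleftrightarrow> successively (\<lambda>a b. (a, b) \<in> R) xs"
  by (induction xs rule: vwalk_arcs.induct) auto

lemma arc_form_spokes:
  assumes "finite Z" "a \<notin> Z"
  shows "arc_form ({a} \<times> Z \<union> Z \<times> {a}) x = 2 * x a * sum x Z"
proof -
  have "arc_form ({a} \<times> Z \<union> Z \<times> {a}) x = arc_form ({a} \<times> Z) x + arc_form (Z \<times> {a}) x"
    unfolding arc_form_def using assms by (intro sum.union_disjoint) auto
  then show ?thesis
    by (simp add: arc_form_def sum_distrib_left sum_distrib_right ac_simps
        flip: sum.cartesian_product)
qed

lemma arc_form_disjoint_Un: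
  "finite E \<Longrightarrow> finite F \<Longrightarrow> E \<inter> F = {} \<Longrightarrow> arc_form (E \<union> F) x = arc_form E x + arc_form F x"
  by (simp add: arc_form_def sum.union_disjoint)

text \<open>A path \<open>q 0, \<dots>, q m\<close> together with a branch \<open>B\<close> that is attached to the rest of the graph only at
  \<open>q m\<close>. The vertices \<open>q 1, \<dots>, q m\<close> have no neighbours besides those on the path and, for \<open>q m\<close>,
  in \<open>B\<close>. Everything else in the graph hangs at \<open>q 0\<close>. The shift moves the branch from \<open>q m\<close> to
  \<open>q 0\<close>.\<close>

locale branch_on_path =
  fixes V :: "'a set" and E :: "('a \<times> 'a) set" and q :: "nat \<Rightarrow> 'a" and m :: nat and B :: "'a set"
  assumes finite_V: "finite V" and arcs_V: "E \<subseteq> V \<times> V" and sym_E: "sym E"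
    and irrefl_E: "(x, x) \<notin> E"
    and m_pos: "0 < m" and inj_q: "inj_on q {..m}" and q_V: "i \<le> m \<Longrightarrow> q i \<in> V"
    and B_V: "B \<subseteq> V" and q_notin_B: "i \<le> m \<Longrightarrow> q i \<notin> B"
    and q_arc: "i < m \<Longrightarrow> (q i, q (Suc i)) \<in> E"
    and q_nbr: "0 < i \<Longrightarrow> i \<le> m \<Longrightarrow> (q i, y) \<in> E \<Longrightarrow>
      y = q (i - 1) \<or> i < m \<and> y = q (Suc i) \<or> i = m \<and> y \<in> B"
    and B_nbr: "x \<in> B \<Longrightarrow> (x, y) \<in> E \<Longrightarrow> y \<in> B \<or> y = q m"
begin

definition roots :: "'a set" where
  "roots = {z \<in> B. (q m, z) \<in> E}"

definition kept_arcs :: "('a \<times> 'a) set" where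
  "kept_arcs = E - ({q m} \<times> roots \<union> roots \<times> {q m})"

definition moved_arcs :: "('a \<times> 'a) set" where
  "moved_arcs = kept_arcs \<union> ({q 0} \<times> roots \<union> roots \<times> {q 0})"

abbreviation "P \<equiv> q ` {..m}"

lemma q_eq_iff: "i \<le> m \<Longrightarrow> j \<le> m \<Longrightarrow> q i = q j \<longleftrightarrow> i = j"
  using inj_q by (auto simp: inj_on_def)

lemma E_sym: "(x, y) \<in> E \<Longrightarrow> (y, x) \<in> E"
  using sym_E by (rule symD)

text \<open>Every arc lies on the path, joins the branch to \<open>q m\<close>, lies inside the branch, or lies in the rest
  of the graph, which meets the path only in \<open>q 0\<close>.\<close>

lemma arc_cases:
  assumes "(x, y) \<in> E"
  obtains (up) i where "i < m" "x = q i" "y = q (Suc i)"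
  | (down) i where "i < m" "x = q (Suc i)" "y = q i"
  | (outward) "x = q m" "y \<in> roots"
  | (inward) "x \<in> roots" "y = q m"
  | (branch) "x \<in> B" "y \<in> B"
  | (rest) "x \<notin> B" "y \<notin> B" "x \<notin> q ` {0<..m}" "y \<notin> q ` {0<..m}"
proof -
  have A: thesis if i: "0 < i" "i \<le> m" "x = q i" for i
  proof -
    obtain j where j: "i = Suc j" using i by (cases i) auto
    from q_nbr[of i y] assms i j have "y = q j \<or> i < m \<and> y = q (Suc i) \<or> i = m \<and> y \<in> B" by auto
    then show thesis using i j assms up[of i] down[of j] outward by (auto simp: roots_def)
  qed
  have B: thesis if i: "0 < i" "i \<le> m" "y = q i" for i
  proof -
    obtain j where j: "i = Suc j" using i by (cases i) auto
    from q_nbr[of i x] E_sym[OF assms] i j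
    have "x = q j \<or> i < m \<and> x = q (Suc i) \<or> i = m \<and> x \<in> B" by auto
    then show thesis using i j E_sym[OF assms] up[of j] down[of i] inward by (auto simp: roots_def)
  qed
  have C: thesis if "x \<in> B"
    using B_nbr[OF that assms] branch that E_sym[OF assms] inward by (auto simp: roots_def)
  have D: thesis if "y \<in> B"
    using B_nbr[OF that E_sym[OF assms]] branch that assms outward by (auto simp: roots_def)
  show thesis
  proof (cases "x \<in> q ` {0<..m} \<or> y \<in> q ` {0<..m}")
    case True
    then show thesis using A B by auto
  next
    case False
    then show thesis using C D rest by blast
  qed
qed

lemma roots_B: "roots \<subseteq> B" and roots_notin: "i \<le> m \<Longrightarrow> q i \<notin> roots"
  using q_notin_B by (auto simp: roots_def)

lemma kept_arcsI:
  "i < m \<Longrightarrow> (q i, q (Suc i)) \<in> kept_arcs" "i < m \<Longrightarrow> (q (Suc i), q i) \<in> kept_arcs"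
  "(x, y) \<in> E \<Longrightarrow> x \<in> B \<Longrightarrow> y \<in> B \<Longrightarrow> (x, y) \<in> kept_arcs"
  "(x, y) \<in> E \<Longrightarrow> x \<notin> B \<Longrightarrow> y \<notin> B \<Longrightarrow> (x, y) \<in> kept_arcs"
  using q_arc E_sym roots_notin q_notin_B roots_B m_pos by (auto simp: kept_arcs_def)

lemma moved_arcsI:
  "e \<in> kept_arcs \<Longrightarrow> e \<in> moved_arcs"
  "z \<in> roots \<Longrightarrow> (q 0, z) \<in> moved_arcs" "z \<in> roots \<Longrightarrow> (z, q 0) \<in> moved_arcs"
  by (auto simp: moved_arcs_def)

lemma moved_arcs_V: "moved_arcs \<subseteq> V \<times> V"
  using arcs_V B_V roots_B q_V[of 0] by (auto simp: moved_arcs_def kept_arcs_def)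

lemma sym_moved_arcs: "sym moved_arcs"
  using sym_E by (auto simp: sym_def moved_arcs_def kept_arcs_def)

lemma E_eq: "E = kept_arcs \<union> ({q m} \<times> roots \<union> roots \<times> {q m})"
  using E_sym by (auto simp: kept_arcs_def roots_def)

definition reflect :: "'a \<Rightarrow> 'a" where
  "reflect x = (if x \<in> P then q (m - the_inv_into {..m} q x) else x)"

lemma reflect_q [simp]: "i \<le> m \<Longrightarrow> reflect (q i) = q (m - i)"
  using inj_q by (simp add: reflect_def the_inv_into_f_f)

lemma reflect_notin [simp]: "x \<notin> P \<Longrightarrow> reflect x = x"
  by (simp add: reflect_def)

lemma reflect_B [simp]: "x \<in> B \<Longrightarrow> reflect x = x"
  using q_notin_B by (intro reflect_notin) auto

lemma reflect_mem_iff [simp]: "reflect x \<in> P \<longleftrightarrow> x \<in> P"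
  by (cases "x \<in> P") auto

lemma reflect_reflect [simp]: "reflect (reflect x) = x"
  by (cases "x \<in> P") auto

lemma reflect_V: "x \<in> V \<Longrightarrow> reflect x \<in> V"
  using q_V by (cases "x \<in> P") auto

subsection \<open>The shift is a generalized graph shift\<close>

lemma ggs_step_moved_arcs:
  assumes "\<And>c. graph_cycle \<lparr>pverts = V, parcs = E\<rparr> c \<Longrightarrow> q m \<notin> cycle_verts c"
  shows "ggs_step \<lparr>pverts = V, parcs = E\<rparr> \<lparr>pverts = V, parcs = moved_arcs\<rparr>"
proof -
  let ?G = "\<lparr>pverts = V, parcs = E\<rparr>" and ?p = "map q [0..<Suc m]"
  have dist: "distinct ?p"
    using inj_q by (simp add: distinct_map atLeast0LessThan lessThan_Suc_atMost del: upt_Suc)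
  have "successively (\<lambda>a b. (a, b) \<in> E) ?p"
    using q_arc by (auto simp: successively_conv_nth simp del: upt_Suc)
  then have vpath: "vpath ?p (with_proj ?G)"
    using dist q_V by (auto simp: vpath_def vwalk_def set_vwalk_arcs_subset_iff simp del: upt_Suc)
  have deg: "graph_degree ?G x = 2" if x: "x \<in> set ?p - {q 0, q m}" for x
  proof -
    from x obtain i where i: "0 < i" "i < m" "x = q i"
      by (auto simp del: upt_Suc) (metis le_eq_less_or_eq less_Suc_eq_le not_gr_zero)
    have "(q (Suc (i - 1)), q (i - 1)) \<in> E" using q_arc[of "i - 1"] i E_sym by auto
    then have "neighbours ?G x = {q (i - 1), q (Suc i)}"
      using q_nbr[of i] q_arc[of i] i by (auto simp: neighbours_def)
    then show ?thesis
      using i q_eq_iff[of "i - 1" "Suc i"] by (simp add: graph_degree_eq_card)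
  qed
  have ends: "hd ?p = q 0" "last ?p = q m"
    by (simp_all add: hd_map del: upt_Suc) simp
  have "ggs_admissible ?G (q 0) (q m) ?p"
    using vpath deg ends assms q_eq_iff[of 0 m] m_pos by (auto simp: ggs_admissible_def)
  moreover have "ggs_shift ?G (q 0) (q m) ?p = \<lparr>pverts = V, parcs = moved_arcs\<rparr>"
  proof -
    have "last (butlast ?p) = q (m - 1)"
      using m_pos by (cases m) (auto simp: butlast_append)
    moreover have "neighbours ?G (q m) - {q (m - 1)} = roots"
      using q_nbr[of m] m_pos q_notin_B[of "m - 1"] by (auto simp: neighbours_def roots_def)
    ultimately show ?thesis
      by (simp add: ggs_shift_def moved_arcs_def kept_arcs_def Let_def del: upt_Suc)
  qed
  ultimately show ?thesis unfolding ggs_step_def by metis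
qed

subsection \<open>The quadratic form grows\<close>

lemma finite_arcs: "finite E" "finite kept_arcs" "finite roots"
proof -
  show "finite E" using arcs_V finite_V by (meson finite_SigmaI finite_subset)
  then show "finite kept_arcs" by (simp add: kept_arcs_def)
  show "finite roots" using roots_B B_V finite_V by (meson finite_subset)
qed

lemma arc_form_E: "arc_form E x = arc_form kept_arcs x + 2 * x (q m) * sum x roots"
proof -
  have "kept_arcs \<inter> ({q m} \<times> roots \<union> roots \<times> {q m}) = {}" by (auto simp: kept_arcs_def)
  then show ?thesis
    using finite_arcs roots_notin[of m]
    by (subst E_eq) (simp add: arc_form_disjoint_Un arc_form_spokes)
qed

lemma arc_form_moved_arcs:
  "arc_form moved_arcs x = arc_form kept_arcs x + 2 * x (q 0) * sum x roots"
proof -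
  have "(q 0, z) \<notin> E" if "z \<in> roots" for z
    using that roots_B B_nbr[of z "q 0"] E_sym q_notin_B[of 0] q_eq_iff[of 0 m] m_pos by auto
  then have "kept_arcs \<inter> ({q 0} \<times> roots \<union> roots \<times> {q 0}) = {}"
    using E_sym by (auto simp: kept_arcs_def)
  then show ?thesis
    using finite_arcs roots_notin[of 0]
    by (simp add: moved_arcs_def arc_form_disjoint_Un arc_form_spokes)
qed

text \<open>An arc between two path vertices joins consecutive ones, since \<open>q 0\<close> carries no loop, and
  the reflection keeps them consecutive.\<close>

lemma kept_arc_within_path:
  assumes "(a, b) \<in> kept_arcs" "a \<in> P" "b \<in> P"
  shows "(reflect a, reflect b) \<in> kept_arcs"
proof -
  have "(a, b) \<in> E" using assms(1) by (simp add: kept_arcs_def)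
  then show ?thesis
  proof (cases rule: arc_cases)
    case (up i)
    then have "Suc (m - Suc i) = m - i" by simp
    then show ?thesis using up kept_arcsI(2)[of "m - Suc i"] by simp
  next
    case (down i)
    then have "Suc (m - Suc i) = m - i" by simp
    then show ?thesis using down kept_arcsI(1)[of "m - Suc i"] by simp
  next
    case rest
    then have "a = q 0" "b = q 0" using assms(2,3) by (auto simp: image_iff)
    then show ?thesis using \<open>(a, b) \<in> E\<close> irrefl_E by simp
  qed (use assms(2,3) q_notin_B roots_B in auto)
qed

text \<open>The arcs inside the path are permuted by the reflection. The arcs of the rest can only gain,
  since among their ends only \<open>q 0\<close> changes its value, from \<open>x (q 0)\<close> to \<open>x (q m)\<close>, which is at
  least as large.\<close>

lemma arc_form_reflect:
  assumes nonneg: "\<And>i. x i \<ge> 0" and less: "x (q 0) \<le> x (q m)"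
  shows "arc_form kept_arcs x \<le> arc_form kept_arcs (x \<circ> reflect)"
proof -
  \<comment> \<open>Once the arcs inside the path have been permuted, the inequality holds arc by arc.\<close>
  let ?h = "\<lambda>(a, b). if a \<in> P \<and> b \<in> P then (reflect a, reflect b) else (a, b)"
  have inv: "?h (?h e) = e" for e by (cases e) auto
  have "?h ` kept_arcs \<subseteq> kept_arcs"
    using kept_arc_within_path by auto
  then have bij: "bij_betw ?h kept_arcs kept_arcs"
    using inv by (intro bij_betw_byWitness[where f' = ?h]) auto
  have "arc_form kept_arcs x = (\<Sum>e\<in>kept_arcs. case ?h e of (i, j) \<Rightarrow> x i * x j)"
    unfolding arc_form_def by (rule sum.reindex_bij_betw[OF bij, symmetric])
  also have "\<dots> \<le> arc_form kept_arcs (x \<circ> reflect)"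
    unfolding arc_form_def
  proof (intro sum_mono, clarsimp split del: if_split)
    fix a b assume ab: "(a, b) \<in> kept_arcs"
    show "(case if a \<in> P \<and> b \<in> P then (reflect a, reflect b) else (a, b) of (i, j) \<Rightarrow> x i * x j)
        \<le> x (reflect a) * x (reflect b)"
    proof (cases "a \<in> P \<and> b \<in> P")
      case False
      have "(a, b) \<in> E" using ab by (simp add: kept_arcs_def)
      then have "x a \<le> x (reflect a) \<and> x b \<le> x (reflect b)"
      proof (cases rule: arc_cases)
        case rest
        have "x c \<le> x (reflect c)" if "c \<notin> q ` {0<..m}" for c
        proof (cases "c \<in> P")
          case True
          then have "c = q 0" using that by (auto simp: image_iff)
          then show ?thesis using less by simp
        qed simp
        then show ?thesis using rest by blast
      qed (use False ab m_pos in \<open>auto simp: kept_arcs_def\<close>)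
      then show ?thesis using False nonneg by (auto intro: mult_mono)
    qed auto
  qed
  finally show ?thesis .
qed

text \<open>If \<open>x (q m) < x (q 0)\<close>, moving the branch to the vertex with the larger value does not decrease
  the form.
  Otherwise the reflected vector gives \<open>q 0\<close> the value that \<open>q m\<close> had, so the branch contributes
  what it did before.\<close>

lemma moved_arc_form_ge:
  assumes nonneg: "\<And>i. x i \<ge> 0"
  shows "arc_form E x \<le> arc_form moved_arcs x \<or> arc_form E x \<le> arc_form moved_arcs (x \<circ> reflect)"
proof (cases "x (q 0) \<le> x (q m)")
  case True
  have "sum (x \<circ> reflect) roots = sum x roots"
    using roots_B by (intro sum.cong) auto
  then show ?thesis
    using arc_form_reflect[OF nonneg True] by (simp add: arc_form_E arc_form_moved_arcs)
next
  case False
  then have "x (q m) * sum x roots \<le> x (q 0) * sum x roots"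
    using nonneg by (intro mult_right_mono sum_nonneg) auto
  then show ?thesis by (simp add: arc_form_E arc_form_moved_arcs)
qed

lemma norm_sq_reflect:
  fixes x :: "'a \<Rightarrow> real"
  shows "(\<Sum>i\<in>V. (x (reflect i))\<^sup>2) = (\<Sum>i\<in>V. (x i)\<^sup>2)"
proof -
  have "bij_betw reflect V V"
    using reflect_V by (intro bij_betw_byWitness[where f' = reflect]) auto
  from sum.reindex_bij_betw[OF this, of "\<lambda>i. (x i)\<^sup>2"] show ?thesis .
qed

subsection \<open>The Wiener index shrinks\<close>

lemma dist_hom:
  assumes "\<And>x. x \<in> V \<Longrightarrow> f x \<in> V" "\<And>x y. (x, y) \<in> E \<Longrightarrow> f x = f y \<or> (f x, f y) \<in> moved_arcs"
  shows "graph_dist \<lparr>pverts = V, parcs = moved_arcs\<rparr> (f x) (f y)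
    \<le> graph_dist \<lparr>pverts = V, parcs = E\<rparr> x y"
  using assms arcs_V moved_arcs_V by (intro graph_dist_hom_le) (auto simp: pair_wf_digraph_def)

text \<open>After the shift, \<open>q i\<close> is as far from the branch as \<open>q (m - i)\<close> was before. This permutation of
  the pairs of vertices matches each new distance with an old one that is at least as large.\<close>

definition swap_path_branch :: "'a \<times> 'a \<Rightarrow> 'a \<times> 'a" where
  "swap_path_branch = (\<lambda>(x, y). if x \<in> P \<and> y \<in> B then (reflect x, y)
     else if x \<in> B \<and> y \<in> P then (x, reflect y) else (x, y))"

text \<open>The path is turned around, so that the branch at its lower end comes to sit at \<open>q 0\<close>; the rest of
  the graph, attached at \<open>q 0\<close>, is collapsed to \<open>q m\<close>, the image of \<open>q 0\<close>.\<close>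

lemma hom_collapse_rest:
  assumes "(x, y) \<in> E" and "f = (\<lambda>x. if x \<in> P \<union> B then reflect x else q m)"
  shows "f x = f y \<or> (f x, f y) \<in> moved_arcs"
  using assms(1)
proof (cases rule: arc_cases)
  case (up i)
  then have "Suc (m - Suc i) = m - i" by simp
  then show ?thesis
    using up kept_arcsI(2)[of "m - Suc i"] moved_arcsI(1) by (simp add: assms(2))
next
  case (down i)
  then have "Suc (m - Suc i) = m - i" by simp
  then show ?thesis
    using down kept_arcsI(1)[of "m - Suc i"] moved_arcsI(1) by (simp add: assms(2))
next
  case rest
  have "f c = q m" if "c \<notin> B" "c \<notin> q ` {0<..m}" for c
  proof (cases "c \<in> P")
    case True
    then have "c = q 0" using that by (auto simp: image_iff)
    then show ?thesis by (simp add: assms(2))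
  qed (use that in \<open>simp add: assms(2)\<close>)
  then show ?thesis using rest by simp
next
  case branch
  then show ?thesis using assms(1) kept_arcsI(3) moved_arcsI(1) by (simp add: assms(2))
qed (use moved_arcsI roots_B in \<open>auto simp: assms(2)\<close>)

text \<open>Outside the branch the shift changes nothing.\<close>

lemma hom_collapse_branch:
  assumes "(x, y) \<in> E" and "f = (\<lambda>x. if x \<in> B then q m else x)"
  shows "f x = f y \<or> (f x, f y) \<in> moved_arcs"
  using assms(1)
proof (cases rule: arc_cases)
  case (up i)
  then show ?thesis
    using kept_arcsI(1)[of i] moved_arcsI(1) q_notin_B by (simp add: assms(2))
next
  case (down i)
  then show ?thesis
    using kept_arcsI(2)[of i] moved_arcsI(1) q_notin_B by (simp add: assms(2))
next
  case rest
  then show ?thesis using assms(1) kept_arcsI(4) moved_arcsI(1) by (simp add: assms(2))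
qed (use roots_B q_notin_B in \<open>auto simp: assms(2)\<close>)

text \<open>Contracting the path to \<open>q 0\<close> brings the branch to its new place.\<close>

lemma hom_collapse_path:
  assumes "(x, y) \<in> E" and "f = (\<lambda>x. if x \<in> P then q 0 else x)"
  shows "f x = f y \<or> (f x, f y) \<in> moved_arcs"
  using assms(1)
proof (cases rule: arc_cases)
  case rest
  have "f c = c" if "c \<notin> q ` {0<..m}" for c
    using that by (auto simp: assms(2) image_iff)
  then show ?thesis using rest assms(1) kept_arcsI(4) moved_arcsI(1) by simp
next
  case branch
  then have "f x = x" "f y = y" using q_notin_B by (auto simp: assms(2))
  then show ?thesis using branch assms(1) kept_arcsI(3) moved_arcsI(1) by simp
next
  case outward
  then have "f x = q 0" "f y = y" using roots_notin by (auto simp: assms(2))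
  then show ?thesis using outward moved_arcsI(2) by simp
next
  case inward
  then have "f y = q 0" "f x = x" using roots_notin by (auto simp: assms(2))
  then show ?thesis using inward moved_arcsI(3) by simp
qed (auto simp: assms(2))

text \<open>Each pair of vertices is fixed, up to the reflection of a path vertex, by one of the three maps:
  \<open>?r\<close> handles pairs of a path vertex and a branch vertex, \<open>?s\<close> pairs outside the branch, and \<open>?t\<close>
  pairs off the path.\<close>

lemma dist_moved_le:
  assumes "swap_path_branch (x, y) = (x', y')"
  shows "graph_dist \<lparr>pverts = V, parcs = moved_arcs\<rparr> x y
    \<le> graph_dist \<lparr>pverts = V, parcs = E\<rparr> x' y'"
proof -
  let ?r = "\<lambda>x. if x \<in> P \<union> B then reflect x else q m"
  let ?s = "\<lambda>x. if x \<in> B then q m else x"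
  let ?t = "\<lambda>x. if x \<in> P then q 0 else x"
  have r: "graph_dist \<lparr>pverts = V, parcs = moved_arcs\<rparr> (?r a) (?r b)
      \<le> graph_dist \<lparr>pverts = V, parcs = E\<rparr> a b" for a b
    using hom_collapse_rest reflect_V q_V by (intro dist_hom) auto
  have s: "graph_dist \<lparr>pverts = V, parcs = moved_arcs\<rparr> (?s a) (?s b)
      \<le> graph_dist \<lparr>pverts = V, parcs = E\<rparr> a b" for a b
    using hom_collapse_branch q_V by (intro dist_hom) auto
  have t: "graph_dist \<lparr>pverts = V, parcs = moved_arcs\<rparr> (?t a) (?t b)
      \<le> graph_dist \<lparr>pverts = V, parcs = E\<rparr> a b" for a b
    using hom_collapse_path q_V by (intro dist_hom) auto
  have disj: "a \<notin> B" if "a \<in> P" for a using that q_notin_B by auto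
  consider "x \<in> P" "y \<in> B" | "x \<in> B" "y \<in> P" | "x \<notin> B" "y \<notin> B"
    | "x \<notin> P" "y \<notin> P" using disj by blast
  then show ?thesis
  proof cases
    case 1
    then have eq: "x' = reflect x" "y' = y" using assms by (auto simp: swap_path_branch_def)
    then have "?r x' = x" "?r y' = y" using 1 by simp_all
    then show ?thesis using r[of x' y'] by simp
  next
    case 2
    then have eq: "x' = x" "y' = reflect y" using assms disj by (auto simp: swap_path_branch_def)
    then have "?r x' = x" "?r y' = y" using 2 by simp_all
    then show ?thesis using r[of x' y'] by simp
  next
    case 3
    then show ?thesis using assms s[of x y] by (simp add: swap_path_branch_def)
  next
    case 4
    then show ?thesis using assms t[of x y] by (simp add: swap_path_branch_def)
  qed
qed

lemma wiener_moved_arcs_le: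
  "wiener \<lparr>pverts = V, parcs = moved_arcs\<rparr> \<le> wiener \<lparr>pverts = V, parcs = E\<rparr>"
proof -
  let ?d = "graph_dist \<lparr>pverts = V, parcs = moved_arcs\<rparr>" and ?d' = "graph_dist \<lparr>pverts = V, parcs = E\<rparr>"
  have inv: "swap_path_branch (swap_path_branch e) = e" for e
    by (cases e) (auto simp: swap_path_branch_def q_notin_B)
  have "swap_path_branch e \<in> V \<times> V" if "e \<in> V \<times> V" for e
    using that by (cases e) (simp add: swap_path_branch_def reflect_V)
  then have "swap_path_branch ` (V \<times> V) \<subseteq> V \<times> V" by blast
  then have bij: "bij_betw swap_path_branch (V \<times> V) (V \<times> V)"
    using inv by (intro bij_betw_byWitness[where f' = swap_path_branch]) auto
  have "wiener \<lparr>pverts = V, parcs = moved_arcs\<rparr> = (\<Sum>(x, y)\<in>V \<times> V. ?d x y)"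
    by (simp add: wiener_def sum.cartesian_product)
  also have "\<dots> \<le> (\<Sum>e\<in>V \<times> V. case swap_path_branch e of (x, y) \<Rightarrow> ?d' x y)"
    by (intro sum_mono) (auto split: prod.split intro: dist_moved_le)
  also have "\<dots> = (\<Sum>(x, y)\<in>V \<times> V. ?d' x y)"
    by (rule sum.reindex_bij_betw[OF bij])
  also have "\<dots> = wiener \<lparr>pverts = V, parcs = E\<rparr>"
    by (simp add: wiener_def sum.cartesian_product)
  finally show ?thesis .
qed

end

subsection \<open>Comparison of spectral radii\<close>

lemma adj_sigma_moved_arcs_ge:
  assumes "branch_on_path {..<n} E q m B" and "0 < n"
  shows "adj_sigma \<lparr>pverts = {..<n}, parcs = E\<rparr>
    \<le> adj_sigma \<lparr>pverts = {..<n}, parcs = branch_on_path.moved_arcs E q m B\<rparr>"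
proof -
  interpret branch_on_path "{..<n}" E q m B by fact
  show ?thesis
  proof (rule adj_sigma_mono[where n = n])
    fix x :: "nat \<Rightarrow> real" assume "\<And>i. x i \<ge> 0"
    moreover have "norm_sq n (x \<circ> reflect) = norm_sq n x"
      using norm_sq_reflect[of x] by (simp add: norm_sq_def)
    ultimately show "\<exists>y. norm_sq n y = norm_sq n x \<and>
        arc_form (parcs \<lparr>pverts = {..<n}, parcs = E\<rparr>) x
        \<le> arc_form (parcs \<lparr>pverts = {..<n}, parcs = moved_arcs\<rparr>) y"
      using moved_arc_form_ge[of x] by (metis pair_pre_digraph.select_convs(2))
  qed (use arcs_V moved_arcs_V sym_E sym_moved_arcs \<open>0 < n\<close> in auto)
qed

section \<open>Unicyclic graphs as rooted trees\<close>

lemma closed_arcs_set: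
  "(x, y) \<in> closed_arcs xs \<Longrightarrow> x \<in> set xs \<and> y \<in> set xs"
  using closed_arcs_subset by fastforce

lemma closed_arcs_unique:
  assumes "distinct xs"
  shows "(x, y) \<in> closed_arcs xs \<Longrightarrow> (x, z) \<in> closed_arcs xs \<Longrightarrow> y = z"
    and "(y, x) \<in> closed_arcs xs \<Longrightarrow> (z, x) \<in> closed_arcs xs \<Longrightarrow> y = z"
proof -
  have "distinct (rotate1 xs)" using assms by simp
  then show "(y, x) \<in> closed_arcs xs \<Longrightarrow> (z, x) \<in> closed_arcs xs \<Longrightarrow> y = z"
    unfolding closed_arcs_def in_set_zip by (force simp: nth_eq_iff_index_eq)
  show "(x, y) \<in> closed_arcs xs \<Longrightarrow> (x, z) \<in> closed_arcs xs \<Longrightarrow> y = z"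
    using assms unfolding closed_arcs_def in_set_zip by (force simp: nth_eq_iff_index_eq)
qed

lemma closed_arcs_two_nbrs:
  assumes "distinct xs" "3 \<le> length xs" "x \<in> set xs"
  obtains y z where "(x, y) \<in> closed_arcs xs" "(z, x) \<in> closed_arcs xs" "y \<noteq> z"
proof -
  let ?l = "length xs"
  obtain i where i: "i < ?l" "x = xs ! i" using assms(3) by (auto simp: in_set_conv_nth)
  have "x \<in> set (rotate1 xs)" using assms(3) by simp
  then have "\<exists>j<length (rotate1 xs). rotate1 xs ! j = x" by (simp only: in_set_conv_nth)
  then obtain j where j: "j < ?l" "x = xs ! (Suc j mod ?l)"
    by (auto simp: nth_rotate1)
  have lt: "Suc i mod ?l < ?l" "Suc j mod ?l < ?l" using i by (auto intro: mod_less_divisor)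
  have "Suc j mod ?l = i"
    using i j lt assms(1) by (metis nth_eq_iff_index_eq)
  then have "Suc i mod ?l \<noteq> j"
    using i(1) j(1) assms(2) by (auto simp: mod_Suc split: if_splits)
  then have "xs ! (Suc i mod ?l) \<noteq> xs ! j"
    using lt j assms(1) by (simp add: nth_eq_iff_index_eq)
  moreover have "(x, xs ! (Suc i mod ?l)) \<in> closed_arcs xs" "(xs ! j, x) \<in> closed_arcs xs"
    using i j by (auto simp: closed_arcs_nth)
  ultimately show ?thesis using that by blast
qed

lemma closed_arcs_closed_set:
  assumes "x \<in> set xs" "x \<in> S" "\<And>y z. y \<in> S \<Longrightarrow> (y, z) \<in> closed_arcs xs \<Longrightarrow> z \<in> S"
  shows "set xs \<subseteq> S"
proof -
  let ?l = "length xs"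
  obtain i where i: "i < ?l" "x = xs ! i" using assms(1) by (auto simp: in_set_conv_nth)
  have step: "xs ! ((i + j) mod ?l) \<in> S" for j
  proof (induction j)
    case 0
    then show ?case using i assms(2) by simp
  next
    case (Suc j)
    have "(i + j) mod ?l < ?l" using i by (auto intro: mod_less_divisor)
    then have "(xs ! ((i + j) mod ?l), xs ! (Suc ((i + j) mod ?l) mod ?l)) \<in> closed_arcs xs"
      by (auto simp: closed_arcs_nth)
    from assms(3)[OF Suc this] show ?case by (simp add: mod_Suc_eq)
  qed
  show ?thesis
  proof
    fix y assume "y \<in> set xs"
    then obtain j where "j < ?l" "y = xs ! j" by (auto simp: in_set_conv_nth)
    then show "y \<in> S" using step[of "?l - i + j"] i by simp
  qed
qed

definition unicycle :: "'a list \<Rightarrow> 'a set \<Rightarrow> ('a \<Rightarrow> 'a) \<Rightarrow> 'a pair_pre_digraph" where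
  "unicycle cs T par = \<lparr>pverts = set cs \<union> T,
     parcs = {(x, y). (x, y) \<in> closed_arcs cs \<or> (y, x) \<in> closed_arcs cs \<or>
       x \<in> T \<and> y = par x \<or> y \<in> T \<and> x = par y}\<rparr>"

lemma pverts_unicycle [simp]: "pverts (unicycle cs T par) = set cs \<union> T"
  by (simp add: unicycle_def)

lemma parcs_unicycle: "(x, y) \<in> parcs (unicycle cs T par) \<longleftrightarrow>
    (x, y) \<in> closed_arcs cs \<or> (y, x) \<in> closed_arcs cs \<or> x \<in> T \<and> y = par x \<or> y \<in> T \<and> x = par y"
  by (simp add: unicycle_def)

lemma sym_unicycle: "sym (parcs (unicycle cs T par))"
  by (auto simp: sym_def parcs_unicycle)

text \<open>The parents lead to the head of \<open>cs\<close>, the only cycle vertex with a tree attached. That they do so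
  without running in circles is expressed by a rank \<open>d\<close> that decreases towards the root. It only
  has to decrease, so the same \<open>d\<close> remains valid when children are lifted to an ancestor.\<close>

locale rooted_unicycle =
  fixes cs :: "'a list" and T :: "'a set" and par :: "'a \<Rightarrow> 'a"
  assumes distinct_cs: "distinct cs" and length_cs: "3 \<le> length cs"
    and finite_T: "finite T" and disjoint: "set cs \<inter> T = {}"
    and ranked: "\<exists>d :: 'a \<Rightarrow> nat. \<forall>x\<in>T. par x = hd cs \<or> par x \<in> T \<and> d (par x) < d x"
begin

abbreviation "G \<equiv> unicycle cs T par"

lemma root_in: "hd cs \<in> set cs"
  using length_cs by (cases cs) auto

lemma root_notin_T: "hd cs \<notin> T"
  using root_in disjoint by auto

lemma par_cases: "x \<in> T \<Longrightarrow> par x = hd cs \<or> par x \<in> T"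
  using ranked by auto

lemma par_neq: "x \<in> T \<Longrightarrow> par x \<noteq> x"
  using ranked root_notin_T by force

lemma par_notin_cycle: "x \<in> T \<Longrightarrow> y \<in> set cs \<Longrightarrow> y \<noteq> hd cs \<Longrightarrow> par x \<noteq> y"
  using par_cases disjoint by auto

lemma tree_arc_iff:
  "x \<in> T \<Longrightarrow> (x, y) \<in> parcs G \<longleftrightarrow> y = par x \<or> y \<in> T \<and> par y = x"
  using disjoint closed_arcs_subset[of cs] by (auto simp: parcs_unicycle)

lemma cycle_arc_iff:
  "x \<in> set cs \<Longrightarrow> y \<in> set cs \<Longrightarrow>
    (x, y) \<in> parcs G \<longleftrightarrow> (x, y) \<in> closed_arcs cs \<or> (y, x) \<in> closed_arcs cs"
  using disjoint by (auto simp: parcs_unicycle)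

lemma pair_graph_unicycle: "pair_graph G"
proof -
  have "x \<in> set cs \<union> T \<and> y \<in> set cs \<union> T" if "(x, y) \<in> parcs G" for x y
    using that par_cases[of x] par_cases[of y] root_in closed_arcs_set[of x y cs]
      closed_arcs_set[of y x cs] by (auto simp: parcs_unicycle)
  then have V: "parcs G \<subseteq> pverts G \<times> pverts G" by auto
  have fin: "finite (pverts G)" using finite_T by simp
  have "(x, x) \<notin> closed_arcs cs" for x
  proof
    assume a: "(x, x) \<in> closed_arcs cs"
    then have "x \<in> set cs" using closed_arcs_subset by fastforce
    then obtain y z where "(x, y) \<in> closed_arcs cs" "(z, x) \<in> closed_arcs cs" "y \<noteq> z"
      using closed_arcs_two_nbrs[OF distinct_cs length_cs] by blast
    with a show False using closed_arcs_unique[OF distinct_cs] by metis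
  qed
  then have loop: "(x, x) \<notin> parcs G" for x
    using par_neq[of x] by (auto simp: parcs_unicycle)
  show ?thesis
  proof
    show "symmetric (with_proj G)" using sym_unicycle by (simp add: symmetric_def)
    show "finite (parcs G)" using V fin by (meson finite_SigmaI finite_subset)
  qed (use V fin loop in auto)
qed

lemma pair_wf_unicycle: "pair_wf_digraph G"
proof -
  interpret pair_graph G by (rule pair_graph_unicycle)
  show ?thesis by (rule pair_wf_digraph)
qed

lemma reach_root:
  assumes "x \<in> pverts G"
  shows "(x, hd cs) \<in> (parcs G)\<^sup>*"
proof -
  have cyc: "(x, hd cs) \<in> (parcs G)\<^sup>*" if "x \<in> set cs" for x
  proof -
    have "set cs \<subseteq> {x. (x, hd cs) \<in> (parcs G)\<^sup>*}"
    proof (rule closed_arcs_closed_set)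
      fix y z assume "y \<in> {x. (x, hd cs) \<in> (parcs G)\<^sup>*}" "(y, z) \<in> closed_arcs cs"
      then show "z \<in> {x. (x, hd cs) \<in> (parcs G)\<^sup>*}"
        by (auto simp: parcs_unicycle intro: converse_rtrancl_into_rtrancl)
    qed (use root_in in auto)
    then show ?thesis using that by auto
  qed
  obtain d :: "'a \<Rightarrow> nat" where d: "\<forall>x\<in>T. par x = hd cs \<or> par x \<in> T \<and> d (par x) < d x"
    using ranked by blast
  have "(x, hd cs) \<in> (parcs G)\<^sup>*" if "x \<in> T" for x
    using that
  proof (induction "d x" arbitrary: x rule: less_induct)
    case less
    have "(par x, hd cs) \<in> (parcs G)\<^sup>*" using d less by force
    moreover have "(x, par x) \<in> parcs G" using less.prems by (simp add: parcs_unicycle)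
    ultimately show ?case by (rule converse_rtrancl_into_rtrancl[rotated])
  qed
  then show ?thesis using assms cyc by auto
qed

lemma reach:
  assumes "x \<in> pverts G" "y \<in> pverts G"
  shows "(x, y) \<in> (parcs G)\<^sup>*"
proof -
  have "(hd cs, y) \<in> (parcs G)\<^sup>*"
    using reach_root[OF assms(2)] sym_unicycle by (meson sym_rtrancl symD)
  with reach_root[OF assms(1)] show ?thesis by (rule rtrancl_trans)
qed

lemma child_of_root:
  assumes "T \<noteq> {}"
  obtains x where "x \<in> T" "par x = hd cs"
proof -
  obtain d :: "'a \<Rightarrow> nat" where d: "\<forall>x\<in>T. par x = hd cs \<or> par x \<in> T \<and> d (par x) < d x"
    using ranked by blast
  obtain x where x: "x \<in> T" "\<forall>y\<in>T. d x \<le> d y"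
    using assms finite_T by (metis ex_is_arg_min_if_finite is_arg_min_linorder)
  then have "par x = hd cs" using d by force
  with x that show ?thesis by blast
qed

text \<open>A tree vertex of maximal rank on a cycle would have its parent as its only neighbour on the cycle,
  but it has two.\<close>

lemma cycle_within:
  assumes xs: "distinct xs" "3 \<le> length xs" "closed_arcs xs \<subseteq> parcs G"
  shows "set xs \<subseteq> set cs"
proof (rule ccontr)
  obtain d :: "'a \<Rightarrow> nat" where d: "\<forall>x\<in>T. par x = hd cs \<or> par x \<in> T \<and> d (par x) < d x"
    using ranked by blast
  interpret pair_graph G by (rule pair_graph_unicycle)
  have "set xs \<subseteq> set cs \<union> T"
  proof
    fix x assume "x \<in> set xs"
    then obtain y where "(x, y) \<in> closed_arcs xs" using closed_arcs_two_nbrs xs by metis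
    then show "x \<in> set cs \<union> T" using xs(3) in_arcsD1 by auto
  qed
  moreover assume "\<not> set xs \<subseteq> set cs"
  ultimately have "set xs \<inter> T \<noteq> {}" by auto
  then have "Max (d ` (set xs \<inter> T)) \<in> d ` (set xs \<inter> T)" by (intro Max_in) auto
  then obtain x where x: "x \<in> set xs \<inter> T" "d x = Max (d ` (set xs \<inter> T))" by auto
  have max: "d y \<le> d x" if "y \<in> set xs \<inter> T" for y
    using that by (simp add: x(2))
  obtain y z where yz: "(x, y) \<in> closed_arcs xs" "(z, x) \<in> closed_arcs xs" "y \<noteq> z"
    using closed_arcs_two_nbrs xs x by (metis IntD1)
  have "w = par x" if "w \<in> set xs" "(x, w) \<in> parcs G" for w
  proof (rule ccontr)
    assume "w \<noteq> par x"
    then have "w \<in> T" "par w = x" using that x tree_arc_iff by auto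
    then have "d x < d w" using d x(1) root_notin_T by auto
    then show False using max[of w] that(1) \<open>w \<in> T\<close> by simp
  qed
  moreover have "y \<in> set xs" "z \<in> set xs" using yz closed_arcs_subset by fastforce+
  moreover have "(x, y) \<in> parcs G" "(x, z) \<in> parcs G"
    using yz xs(3) arcs_symmetric by auto
  ultimately show False using yz(3) by metis
qed

text \<open>A cycle inside \<open>cs\<close> has two neighbours at each of its vertices, one of which is the successor in
  \<open>cs\<close>. So it contains all of \<open>cs\<close> and all its edges.\<close>

lemma cycle_edges_unique:
  assumes xs: "distinct xs" "3 \<le> length xs" "closed_arcs xs \<subseteq> parcs G"
  shows "(\<lambda>(x, y). {x, y}) ` closed_arcs xs = (\<lambda>(x, y). {x, y}) ` closed_arcs cs"
proof -
  let ?e = "\<lambda>(x, y). {x, y}"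
  have sub: "set xs \<subseteq> set cs" by (rule cycle_within[OF xs])
  have arcs: "(x, y) \<in> closed_arcs cs \<or> (y, x) \<in> closed_arcs cs" if "(x, y) \<in> closed_arcs xs" for x y
  proof -
    have "x \<in> set cs" "y \<in> set cs" using that closed_arcs_subset[of xs] sub by auto
    then show ?thesis using that xs(3) cycle_arc_iff by blast
  qed
  have succ: "z \<in> set xs \<and> {x, z} \<in> ?e ` closed_arcs xs"
    if x: "x \<in> set xs" and z: "(x, z) \<in> closed_arcs cs" for x z
  proof -
    obtain y y' where y: "(x, y) \<in> closed_arcs xs" "(y', x) \<in> closed_arcs xs" "y \<noteq> y'"
      using closed_arcs_two_nbrs xs x by metis
    have "z = y \<or> z = y'"
      using arcs[OF y(1)] arcs[OF y(2)] y(3) z closed_arcs_unique[OF distinct_cs] by metis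
    then show ?thesis
    proof
      assume "z = y"
      then show ?thesis using y(1) closed_arcs_subset[of xs] by force
    next
      assume "z = y'"
      then have "{x, z} = ?e (y', x)" by auto
      then show ?thesis using y(2) \<open>z = y'\<close> closed_arcs_subset[of xs] by blast
    qed
  qed
  obtain x where "x \<in> set xs" using xs(2) by (cases xs) auto
  have all: "set cs \<subseteq> set xs"
  proof (rule closed_arcs_closed_set)
    show "x \<in> set cs" "x \<in> set xs" using \<open>x \<in> set xs\<close> sub by auto
  qed (rule succ[THEN conjunct1])
  show ?thesis
  proof
    show "?e ` closed_arcs xs \<subseteq> ?e ` closed_arcs cs"
    proof clarsimp
      fix x y assume "(x, y) \<in> closed_arcs xs"
      from arcs[OF this] show "{x, y} \<in> ?e ` closed_arcs cs"
        by (force simp: insert_commute)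
    qed
    show "?e ` closed_arcs cs \<subseteq> ?e ` closed_arcs xs"
    proof clarsimp
      fix x z assume xz: "(x, z) \<in> closed_arcs cs"
      then have "x \<in> set xs" using closed_arcs_set all by fastforce
      then show "{x, z} \<in> ?e ` closed_arcs xs" using succ xz by blast
    qed
  qed
qed

lemma graph_cycle_verts: "graph_cycle G c \<Longrightarrow> cycle_verts c \<subseteq> set cs"
  unfolding graph_cycle_iff[OF pair_wf_unicycle] using cycle_within cycle_verts_zip by metis

lemma graph_cycle_cs: "graph_cycle G (zip cs (rotate1 cs))"
  unfolding graph_cycle_iff[OF pair_wf_unicycle] using distinct_cs length_cs
  by (intro exI[of _ cs]) (auto simp: parcs_unicycle)

lemma unicyclic_unicycle: "unicyclic G"
  unfolding unicyclic_def
proof (rule ex1I)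
  show "\<exists>c. graph_cycle G c \<and> cycle_edges c = cycle_edges (zip cs (rotate1 cs))"
    using graph_cycle_cs by blast
  fix E assume "\<exists>c. graph_cycle G c \<and> cycle_edges c = E"
  then show "E = cycle_edges (zip cs (rotate1 cs))"
    using cycle_edges_unique by (auto simp: graph_cycle_iff[OF pair_wf_unicycle] cycle_edges_zip)
qed

lemma degree_cycle_vertex:
  assumes "x \<in> set cs" "x \<noteq> hd cs"
  shows "graph_degree G x = 2"
proof -
  obtain y z where yz: "(x, y) \<in> closed_arcs cs" "(z, x) \<in> closed_arcs cs" "y \<noteq> z"
    using closed_arcs_two_nbrs[OF distinct_cs length_cs assms(1)] by blast
  have "neighbours G x = {y, z}"
    using yz assms closed_arcs_unique[OF distinct_cs] disjoint par_notin_cycle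
    by (auto simp: neighbours_def parcs_unicycle) (metis)+
  then show ?thesis using yz by (simp add: graph_degree_eq_card)
qed

lemma degree_root:
  assumes "T \<noteq> {}"
  shows "3 \<le> graph_degree G (hd cs)"
proof -
  obtain y z where yz: "(hd cs, y) \<in> closed_arcs cs" "(z, hd cs) \<in> closed_arcs cs" "y \<noteq> z"
    using closed_arcs_two_nbrs[OF distinct_cs length_cs root_in] by blast
  obtain x where x: "x \<in> T" "par x = hd cs" using child_of_root[OF assms] .
  have "y \<in> set cs" "z \<in> set cs" using yz closed_arcs_subset[of cs] by auto
  then have "x \<noteq> y" "x \<noteq> z" using x disjoint by auto
  then have "card {x, y, z} = 3" using yz(3) by simp
  moreover have "{x, y, z} \<subseteq> neighbours G (hd cs)"
    using x yz by (auto simp: neighbours_def parcs_unicycle)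
  moreover have "finite (neighbours G (hd cs))"
  proof -
    interpret pair_graph G by (rule pair_graph_unicycle)
    have "neighbours G (hd cs) \<subseteq> pverts G" using in_arcsD2 by (auto simp: neighbours_def)
    then show ?thesis using pair_finite_verts by (rule finite_subset)
  qed
  ultimately show ?thesis by (metis card_mono graph_degree_eq_card)
qed

end

lemma unicycle_in_Omega:
  assumes "rooted_unicycle cs T par" and V: "set cs \<union> T = {..<n}" and "length cs = k" and "k < n"
  shows "unicycle cs T par \<in> Omega k n"
proof -
  interpret rooted_unicycle cs T par by fact
  have "T \<noteq> {}"
  proof
    assume "T = {}"
    then have "card {..<n} = length cs" using distinct_card[OF distinct_cs] V by simp
    then show False using assms by simp
  qed
  have "Digraph_Component.connected (with_proj G)"
    unfolding connected_iff_rtrancl[OF pair_wf_unicycle sym_unicycle]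
    using reach root_in by auto
  moreover have "\<exists>!v. v \<in> cycle_verts (zip cs (rotate1 cs)) \<and> graph_degree G v \<noteq> 2"
    unfolding cycle_verts_zip
    using degree_root[OF \<open>T \<noteq> {}\<close>] degree_cycle_vertex root_in by (intro ex1I[of _ "hd cs"]) auto
  ultimately show ?thesis
    unfolding Omega_def
    by (intro CollectI conjI exI[of _ "zip cs (rotate1 cs)"])
       (simp_all add: pair_graph_unicycle unicyclic_unicycle graph_cycle_cs V assms(3))
qed

text \<open>Starting from the cycle, the tree is grown as far as possible inside \<open>G\<close>. A maximal tree reaches
  every vertex by connectivity; it can grow only from the root or from tree vertices because the
  other cycle vertices have degree two. An edge of \<open>G\<close> outside the resulting connected graph would
  lie on a second cycle.\<close>

lemma Omega_imp_unicycle: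
  assumes "G \<in> Omega k n"
  obtains cs T par where "rooted_unicycle cs T par" "G = unicycle cs T par" "length cs = k"
proof -
  from assms have G: "pair_graph G" "pverts G = {..<n}" "Digraph_Component.connected (with_proj G)"
    "unicyclic G" by (auto simp: Omega_def)
  interpret G: pair_graph G by fact
  have symG: "sym (parcs G)" using G.arcs_symmetric by (rule symI)
  obtain c where c: "graph_cycle G c" "length c = k"
    and ex1: "\<exists>!v. v \<in> cycle_verts c \<and> graph_degree G v \<noteq> 2"
    using assms by (auto simp: Omega_def)
  obtain v where v: "v \<in> cycle_verts c"
    and deg: "\<And>x. x \<in> cycle_verts c \<Longrightarrow> x \<noteq> v \<Longrightarrow> graph_degree G x = 2"
    using ex1 by metis
  obtain xs where xs: "c = zip xs (rotate1 xs)" "distinct xs" "3 \<le> length xs"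
    "closed_arcs xs \<subseteq> parcs G"
    using c(1) graph_cycle_iff[OF G.pair_wf_digraph] by blast
  obtain ys zs where split: "xs = ys @ v # zs"
    using v unfolding xs(1) cycle_verts_zip by (meson split_list)
  \<comment> \<open>The cycle is rotated so that it starts with its vertex of degree other than two.\<close>
  define cs where "cs = v # zs @ ys"
  have rot: "rotate (length ys) xs = cs"
    unfolding split cs_def by (simp add: rotate_append)
  have cs: "distinct cs" "3 \<le> length cs" "length cs = k" "set cs = cycle_verts c" "hd cs = v"
    using xs c(2) unfolding xs(1) cycle_verts_zip by (auto simp: split cs_def)
  have arcs_cs: "closed_arcs cs = closed_arcs xs"
    using closed_arcs_rotate[of "length ys" xs] rot by simp
  have cs_V: "set cs \<subseteq> pverts G"
  proof
    fix x assume "x \<in> set cs"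
    then obtain y where "(x, y) \<in> closed_arcs cs" using closed_arcs_two_nbrs cs(1,2) by metis
    then show "x \<in> pverts G" using xs(4) arcs_cs G.in_arcsD1 by auto
  qed
  let ?Q = "\<lambda>T. T \<subseteq> pverts G \<and> (\<exists>par. rooted_unicycle cs T par \<and> parcs (unicycle cs T par) \<subseteq> parcs G)"
  have "rooted_unicycle cs {} id" using cs by unfold_locales auto
  moreover have "parcs (unicycle cs {} id) \<subseteq> parcs G"
    using xs(4) arcs_cs G.arcs_symmetric by (auto simp: unicycle_def)
  ultimately have "{} \<in> Collect ?Q" by (intro CollectI conjI exI[of _ id]) simp_all
  then have ne: "Collect ?Q \<noteq> {}" by (metis empty_iff)
  have fin: "finite (Collect ?Q)"
    by (rule finite_subset[of _ "Pow (pverts G)"]) (auto simp: G.pair_finite_verts)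
  from finite_has_maximal[OF fin ne] obtain T where "T \<in> Collect ?Q"
    and max': "\<forall>T'\<in>Collect ?Q. T \<subseteq> T' \<longrightarrow> T = T'" by (rule bexE)
  then have T: "?Q T" by simp
  have max: "T' = T" if "?Q T'" "T \<subseteq> T'" for T'
    by (rule sym, rule max'[rule_format]) (use that in simp_all)
  from T
obtain par where par: "rooted_unicycle cs T par" "parcs (unicycle cs T par) \<subseteq> parcs G"
    by blast
  interpret U: rooted_unicycle cs T par by fact
  obtain d :: "nat \<Rightarrow> nat" where d: "\<forall>x\<in>T. par x = hd cs \<or> par x \<in> T \<and> d (par x) < d x"
    using U.ranked by blast
  have all: "pverts G \<subseteq> set cs \<union> T"
  proof (rule ccontr)
    assume "\<not> pverts G \<subseteq> set cs \<union> T"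
    then obtain y where y: "y \<in> pverts G" "y \<notin> set cs \<union> T" by blast
    have "(v, y) \<in> (parcs G)\<^sup>*"
      using G(3) y cs_V cs(5) U.root_in unfolding connected_iff_rtrancl[OF G.pair_wf_digraph symG] by blast
    moreover have "v \<in> set cs \<union> T" using U.root_in cs(5) by simp
    ultimately obtain a b where ab: "(a, b) \<in> parcs G" "a \<in> set cs \<union> T" "b \<notin> set cs \<union> T"
      using y(2) by (induction rule: rtrancl_induct) blast+
    have "a = v" if a_cs: "a \<in> set cs"
    proof (rule ccontr)
      assume "a \<noteq> v"
      obtain s t where st: "(a, s) \<in> closed_arcs cs" "(t, a) \<in> closed_arcs cs" "s \<noteq> t"
        using closed_arcs_two_nbrs[OF cs(1,2) a_cs] by blast
      have "{b, s, t} \<subseteq> neighbours G a"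
        using st ab(1) xs(4) arcs_cs G.arcs_symmetric by (auto simp: neighbours_def)
      moreover have "finite (neighbours G a)"
        using G.in_arcsD2 by (intro finite_subset[OF _ G.pair_finite_verts]) (auto simp: neighbours_def)
      moreover have "s \<in> set cs" "t \<in> set cs" using st closed_arcs_subset[of cs] by auto
      then have "b \<noteq> s" "b \<noteq> t" using ab(3) by auto
      then have "card {b, s, t} = 3" using st(3) by simp
      ultimately have "3 \<le> graph_degree G a" by (metis card_mono graph_degree_eq_card)
      then show False using deg[of a] a_cs \<open>a \<noteq> v\<close> cs(4) by simp
    qed
    then have a: "a = hd cs \<or> a \<in> T" using ab(2) cs(5) by blast
    \<comment> \<open>The new leaf is ranked just above its parent; nothing has it as parent yet.\<close>
    let ?par = "par(b := a)" and ?d = "d(b := Suc (d a))"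
    have "\<forall>x\<in>insert b T. ?par x = hd cs \<or> ?par x \<in> insert b T \<and> ?d (?par x) < ?d x"
      using d a ab(3) by auto
    then have "rooted_unicycle cs (insert b T) ?par"
      using cs U.finite_T U.disjoint ab(3) by unfold_locales blast+
    moreover have "parcs (unicycle cs (insert b T) ?par) \<subseteq> parcs G"
    proof clarify
      fix x y assume "(x, y) \<in> parcs (unicycle cs (insert b T) ?par)"
      then have "(x, y) \<in> parcs (unicycle cs T par) \<or> (x, y) = (a, b) \<or> (x, y) = (b, a)"
        by (auto simp: parcs_unicycle split: if_splits)
      then show "(x, y) \<in> parcs G" using par(2) ab(1) G.arcs_symmetric by auto
    qed
    moreover have "insert b T \<subseteq> pverts G" using T ab(1) G.in_arcsD2 by auto
    ultimately have "insert b T = T" by (intro max) auto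
    then show False using ab(3) by blast
  qed
  have V: "pverts (unicycle cs T par) = pverts G" using all cs_V T by auto
  have "(x, y) \<in> parcs (unicycle cs T par)" if xy: "(x, y) \<in> parcs G" for x y
  proof (rule ccontr)
    assume new: "(x, y) \<notin> parcs (unicycle cs T par)"
    have "(x, y) \<in> (parcs (unicycle cs T par))\<^sup>*"
      using U.reach V xy G.in_arcsD1 G.in_arcsD2 by metis
    then obtain c' where c': "graph_cycle G c'" "{x, y} \<in> cycle_edges c'"
      using cycle_through_new_edge[OF G.pair_wf_digraph par(2) _ new] G.no_loops' xy
        G.arcs_symmetric by metis
    have "cycle_edges c' = cycle_edges c" using G(4) c(1) c'(1) unfolding unicyclic_def by blast
    then have "{x, y} \<in> (\<lambda>(x, y). {x, y}) ` closed_arcs cs"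
      using c'(2) by (simp add: xs(1) cycle_edges_zip arcs_cs)
    then have "(x, y) \<in> closed_arcs cs \<or> (y, x) \<in> closed_arcs cs"
      by (auto simp: doubleton_eq_iff)
    then show False using new by (auto simp: parcs_unicycle)
  qed
  then have "parcs G = parcs (unicycle cs T par)" using par(2) by auto
  then have "G = unicycle cs T par" using V by simp
  then show ?thesis using that U.rooted_unicycle_axioms cs(3) by blast
qed

section \<open>Shifts in rooted unicyclic graphs\<close>

lemma unicycle_cong:
  "(\<And>x. x \<in> T \<Longrightarrow> par x = par' x) \<Longrightarrow> unicycle cs T par = unicycle cs T par'"
  by (auto simp: unicycle_def)

text \<open>Everything that is to be shown about a chain of shifts.\<close>

definition ggs_improves :: "nat pair_pre_digraph \<Rightarrow> nat pair_pre_digraph \<Rightarrow> bool" where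
  "ggs_improves G H \<longleftrightarrow> ggs_step\<^sup>*\<^sup>* G H \<and> adj_sigma G \<le> adj_sigma H \<and> wiener H \<le> wiener G"

lemma ggs_improves_refl: "ggs_improves G G"
  by (simp add: ggs_improves_def)

lemma ggs_improves_trans: "ggs_improves G H \<Longrightarrow> ggs_improves H K \<Longrightarrow> ggs_improves G K"
  by (auto simp: ggs_improves_def)

text \<open>A path that descends in the tree and whose inner vertices have no children off the path.
  The branch at its end consists of the descendants of \<open>q m\<close>.\<close>

locale descending_path = rooted_unicycle +
  fixes q :: "nat \<Rightarrow> 'a" and m :: nat
  assumes m_pos: "0 < m" and inj_q: "inj_on q {..m}" and q_0: "q 0 = hd cs \<or> q 0 \<in> T"
    and q_T: "0 < i \<Longrightarrow> i \<le> m \<Longrightarrow> q i \<in> T"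
    and par_q: "i < m \<Longrightarrow> par (q (Suc i)) = q i"
    and unbranched: "0 < i \<Longrightarrow> i < m \<Longrightarrow> x \<in> T \<Longrightarrow> par x = q i \<Longrightarrow> x = q (Suc i)"
begin

definition descendants :: "'a set" where
  "descendants = {x \<in> T. (x, q m) \<in> {(y, par y) |y. y \<in> T}\<^sup>+}"

lemma descendants_iff:
  assumes "x \<in> T"
  shows "x \<in> descendants \<longleftrightarrow> par x = q m \<or> par x \<in> descendants"
proof
  let ?A = "{(y, par y) |y. y \<in> T}"
  assume "x \<in> descendants"
  then have "(x, q m) \<in> ?A\<^sup>+" by (simp add: descendants_def)
  then obtain z where z: "(x, z) \<in> ?A" "(z, q m) \<in> ?A\<^sup>*" by (meson tranclD)
  then have "z = par x" by auto
  then have "par x = q m \<or> (par x, q m) \<in> ?A\<^sup>+" using z(2) by (auto simp: rtrancl_eq_or_trancl)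
  moreover have "par x \<in> T" if "(par x, q m) \<in> ?A\<^sup>+" using tranclD[OF that] by auto
  ultimately show "par x = q m \<or> par x \<in> descendants" by (auto simp: descendants_def)
next
  let ?A = "{(y, par y) |y. y \<in> T}"
  have "(x, par x) \<in> ?A" using assms by auto
  moreover assume "par x = q m \<or> par x \<in> descendants"
  ultimately have "(x, q m) \<in> ?A\<^sup>+" by (auto simp: descendants_def intro: trancl_into_trancl2)
  then show "x \<in> descendants" using assms by (simp add: descendants_def)
qed

lemma descendants_T: "descendants \<subseteq> T"
  by (auto simp: descendants_def)

lemma descendants_rank:
  assumes d: "\<forall>x\<in>T. par x = hd cs \<or> par x \<in> T \<and> d (par x) < (d x :: nat)" and x: "x \<in> descendants"
  shows "d (q m) < d x"
proof -
  have "x \<in> T" "(x, q m) \<in> {(y, par y) |y. y \<in> T}\<^sup>+" using x by (auto simp: descendants_def)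
  from this(2,1) show ?thesis
  proof (induction rule: converse_trancl_induct)
    case (base y)
    then show ?case using d q_T[of m] m_pos root_notin_T by auto
  next
    case (step y z)
    then have z: "z = par y" by auto
    have "z \<in> T" using tranclD[OF step.hyps(2)] by auto
    then show ?case using step z d root_notin_T by force
  qed
qed

lemma path_rank:
  assumes d: "\<forall>x\<in>T. par x = hd cs \<or> par x \<in> T \<and> d (par x) < (d x :: nat)"
    and "i \<le> m" "q i \<in> T"
  shows "d (q i) + (m - i) \<le> d (q m)"
  using assms(2,3)
proof (induction i rule: inc_induct)
  case (step i)
  have "q (Suc i) \<in> T" using q_T[of "Suc i"] step.hyps by simp
  moreover have "par (q (Suc i)) = q i" using par_q step.hyps by simp
  ultimately have "d (q i) < d (q (Suc i))" using d step.prems root_notin_T by force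
  then show ?case using step.IH[OF \<open>q (Suc i) \<in> T\<close>] step.hyps by simp
qed simp

lemma path_notin_descendants: "i \<le> m \<Longrightarrow> q i \<notin> descendants"
proof
  assume i: "i \<le> m" "q i \<in> descendants"
  obtain d :: "'a \<Rightarrow> nat" where d: "\<forall>x\<in>T. par x = hd cs \<or> par x \<in> T \<and> d (par x) < d x"
    using ranked by blast
  have "q i \<in> T" using i descendants_T by auto
  then show False using descendants_rank[OF d i(2)] path_rank[OF d i(1)] by simp
qed

sublocale branch_on_path "set cs \<union> T" "parcs G" q m descendants
proof -
  interpret pair_graph G by (rule pair_graph_unicycle)
  show "branch_on_path (set cs \<union> T) (parcs G) q m descendants"
  proof
    fix i y assume i: "0 < i" "i \<le> m" "(q i, y) \<in> parcs G"
    have "par (q i) = q (i - 1)" using par_q[of "i - 1"] i by simp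
    then have "y = q (i - 1) \<or> y \<in> T \<and> par y = q i"
      using i tree_arc_iff[OF q_T] by auto
    then show "y = q (i - 1) \<or> i < m \<and> y = q (Suc i) \<or> i = m \<and> y \<in> descendants"
      using i unbranched[of i y] descendants_iff[of y] by (cases "i = m") auto
  next
    fix x y assume x: "x \<in> descendants" "(x, y) \<in> parcs G"
    then have "x \<in> T" using descendants_T by auto
    then have "y = par x \<or> y \<in> T \<and> par y = x" using tree_arc_iff x by auto
    then show "y \<in> descendants \<or> y = q m" using x \<open>x \<in> T\<close> descendants_iff by auto
  next
    fix i assume "i \<le> m"
    then show "q i \<in> set cs \<union> T" using q_0 q_T[of i] root_in by (cases "i = 0") auto
  next
    fix i assume "i < m"
    then show "(q i, q (Suc i)) \<in> parcs G"
      using par_q[of i] q_T[of "Suc i"] by (auto simp: parcs_unicycle)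
  next
    show "finite (set cs \<union> T)" using finite_T by simp
    show "parcs G \<subseteq> (set cs \<union> T) \<times> (set cs \<union> T)" using in_arcsD1 in_arcsD2 by auto
    show "sym (parcs G)" by (rule sym_unicycle)
    show "(x, x) \<notin> parcs G" for x using no_loops'[of x x] by auto
  qed (use m_pos inj_q descendants_T path_notin_descendants in auto)
qed

abbreviation "lifted \<equiv> \<lambda>x. if par x = q m then q 0 else par x"

lemma roots_eq: "roots = {x \<in> T. par x = q m}"
proof -
  have "q m \<in> T" using q_T m_pos by simp
  moreover have "par (q m) \<notin> descendants"
    using par_q[of "m - 1"] path_notin_descendants[of "m - 1"] m_pos by simp
  ultimately show ?thesis
    using descendants_iff descendants_T by (auto simp: roots_def tree_arc_iff)
qed

lemma moved_arcs_eq: "moved_arcs = parcs (unicycle cs T lifted)"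
proof -
  have qm: "q m \<in> T" "q m \<notin> set cs" using q_T m_pos disjoint by auto
  have "par (q m) \<notin> roots"
    using par_q[of "m - 1"] roots_notin[of "m - 1"] m_pos by simp
  then have neq: "par (par (q m)) \<noteq> q m \<or> par (q m) \<notin> T" by (auto simp: roots_eq)
  have cyc: "(q m, x) \<notin> closed_arcs cs" "(x, q m) \<notin> closed_arcs cs" for x
    using closed_arcs_set qm by fastforce+
  have "(x, y) \<in> moved_arcs \<longleftrightarrow> (x, y) \<in> parcs (unicycle cs T lifted)" for x y
    using qm neq cyc par_neq by (auto simp: moved_arcs_def kept_arcs_def roots_eq parcs_unicycle)
  then show ?thesis by auto
qed

lemma rooted_lifted: "rooted_unicycle cs T lifted"
proof -
  obtain d :: "'a \<Rightarrow> nat" where d: "\<forall>x\<in>T. par x = hd cs \<or> par x \<in> T \<and> d (par x) < d x"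
    using ranked by blast
  have "lifted x = hd cs \<or> lifted x \<in> T \<and> d (lifted x) < d x" if "x \<in> T" for x
  proof (cases "par x = q m")
    case True
    then have "d (q m) < d x" using d that q_T[of m] m_pos root_notin_T by force
    moreover have "d (q 0) < d (q m)" if "q 0 \<in> T" using path_rank[OF d _ that] m_pos by simp
    ultimately show ?thesis using q_0 True by auto
  qed (use d that in auto)
  then show ?thesis
    using distinct_cs length_cs finite_T disjoint by unfold_locales blast+
qed

lemma ggs_step_lifted: "ggs_step G (unicycle cs T lifted)"
proof -
  have "q m \<notin> set cs" using q_T m_pos disjoint by auto
  then have "ggs_step \<lparr>pverts = set cs \<union> T, parcs = parcs G\<rparr> \<lparr>pverts = set cs \<union> T, parcs = moved_arcs\<rparr>"
    using graph_cycle_verts by (intro ggs_step_moved_arcs) (auto simp: unicycle_def)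
  then show ?thesis unfolding moved_arcs_eq by (simp add: unicycle_def)
qed

end

lemma ggs_improves_lifted:
  assumes "descending_path cs T par q m" and V: "set cs \<union> T = {..<n}" and "0 < n"
  shows "ggs_improves (unicycle cs T par) (unicycle cs T (\<lambda>x. if par x = q m then q 0 else par x))"
proof -
  interpret descending_path cs T par q m by fact
  have eq: "\<lparr>pverts = {..<n}, parcs = parcs (unicycle cs T p)\<rparr> = unicycle cs T p" for p
    using V by (simp add: unicycle_def)
  have "branch_on_path {..<n} (parcs G) q m descendants"
    using branch_on_path_axioms by (simp add: V)
  from adj_sigma_moved_arcs_ge[OF this \<open>0 < n\<close>]
  have "adj_sigma G \<le> adj_sigma (unicycle cs T lifted)"
    by (simp only: eq moved_arcs_eq)
  moreover have "wiener (unicycle cs T lifted) \<le> wiener G"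
    using wiener_moved_arcs_le by (simp only: V eq moved_arcs_eq)
  ultimately show ?thesis
    using ggs_step_lifted by (auto simp: ggs_improves_def)
qed

section \<open>Contracting to the star\<close>

text \<open>Among the tree vertices that are not children of the root, take one of least rank. Its parent \<open>w\<close>
  is a child of the root, and the shift along the edge from the root to \<open>w\<close> makes all children of
  \<open>w\<close> children of the root. This can be repeated until all tree vertices are.\<close>

lemma ggs_improves_star:
  assumes "rooted_unicycle cs T par" and V: "set cs \<union> T = {..<n}" and "0 < n"
  shows "ggs_improves (unicycle cs T par) (unicycle cs T (\<lambda>_. hd cs))"
  using assms(1)
proof (induction "card {x \<in> T. par x \<noteq> hd cs}" arbitrary: par rule: less_induct)
  case less
  interpret rooted_unicycle cs T par by fact
  show ?case
  proof (cases "{x \<in> T. par x \<noteq> hd cs} = {}")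
    case True
    then have "unicycle cs T par = unicycle cs T (\<lambda>_. hd cs)" by (intro unicycle_cong) auto
    then show ?thesis by (simp add: ggs_improves_refl)
  next
    case False
    obtain d :: "nat \<Rightarrow> nat" where d: "\<forall>x\<in>T. par x = hd cs \<or> par x \<in> T \<and> d (par x) < d x"
      using ranked by blast
    have fin: "finite {x \<in> T. par x \<noteq> hd cs}" using finite_T by simp
    obtain x where x: "x \<in> T" "par x \<noteq> hd cs"
      and min: "\<And>y. y \<in> T \<Longrightarrow> par y \<noteq> hd cs \<Longrightarrow> d x \<le> d y"
      using ex_is_arg_min_if_finite[OF fin False, of d] by (auto simp: is_arg_min_linorder)
    define w where "w = par x"
    have w: "w \<in> T" "d w < d x" using d x by (auto simp: w_def)
    then have par_w: "par w = hd cs" using min by fastforce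
    let ?q = "\<lambda>i :: nat. if i = 0 then hd cs else w"
    have "w \<noteq> hd cs" using w(1) root_notin_T by auto
    have path: "descending_path cs T par ?q 1"
      using w(1) par_w \<open>w \<noteq> hd cs\<close> by unfold_locales (auto simp: inj_on_def)
    let ?par = "\<lambda>x. if par x = w then hd cs else par x"
    have step: "ggs_improves (unicycle cs T par) (unicycle cs T ?par)"
      using ggs_improves_lifted[OF path V \<open>0 < n\<close>] by (simp cong: if_cong)
    have rooted: "rooted_unicycle cs T ?par"
      using descending_path.rooted_lifted[OF path] by (simp cong: if_cong)
    have "{x \<in> T. ?par x \<noteq> hd cs} \<subseteq> {x \<in> T. par x \<noteq> hd cs} - {x}"
      by (auto simp: w_def)
    also have "\<dots> \<subset> {x \<in> T. par x \<noteq> hd cs}" using x by auto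
    finally have "card {x \<in> T. ?par x \<noteq> hd cs} < card {x \<in> T. par x \<noteq> hd cs}"
      by (intro psubset_card_mono fin)
    from less.hyps[OF this rooted] step show ?thesis by (blast intro: ggs_improves_trans)
  qed
qed

section \<open>Stars and paths as rooted unicyclic graphs\<close>

lemma parcs_unicycle_eq:
  "parcs (unicycle cs T par) = closed_arcs cs \<union> (closed_arcs cs)\<inverse>
    \<union> (\<lambda>x. (x, par x)) ` T \<union> (\<lambda>x. (par x, x)) ` T"
  by (auto simp: parcs_unicycle)

lemma relabel_unicycle:
  assumes "\<And>x. x \<in> T \<Longrightarrow> par' (f x) = f (par x)"
  shows "relabel f (unicycle cs T par) = unicycle (map f cs) (f ` T) par'"
proof -
  have "map_prod f f ` (closed_arcs cs)\<inverse> = (map_prod f f ` closed_arcs cs)\<inverse>" by force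
  moreover have "(\<lambda>x. (f x, f (par x))) ` T = (\<lambda>x. (f x, par' (f x))) ` T"
    "(\<lambda>x. (f (par x), f x)) ` T = (\<lambda>x. (par' (f x), f x)) ` T"
    using assms by auto
  ultimately have "parcs (relabel f (unicycle cs T par)) = parcs (unicycle (map f cs) (f ` T) par')"
    by (simp add: parcs_unicycle_eq closed_arcs_map image_Un image_image)
  moreover have "pverts (relabel f (unicycle cs T par)) = pverts (unicycle (map f cs) (f ` T) par')"
    by (simp add: image_Un)
  ultimately show ?thesis by simp
qed

lemma closed_arcs_upt: "closed_arcs [0..<k] = {(i, Suc i mod k) |i. i < k}"
proof -
  have "Suc i mod k < k" if "i < k" for i using that by (intro mod_less_divisor) simp
  then show ?thesis unfolding closed_arcs_nth by (force simp del: upt_Suc)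
qed

lemma parcs_cycle_graph:
  "parcs (cycle_graph k) = {(i, j). (i, j) \<in> closed_arcs [0..<k] \<or> (j, i) \<in> closed_arcs [0..<k]}"
  by (auto simp: cycle_graph_def closed_arcs_upt)

text \<open>Here \<open>p\<close> is the parent function of the tree \<open>H\<close> rooted at 0, before its vertices 1, 2, \<open>\<dots>\<close> are
  renamed to \<open>k\<close>, \<open>k + 1\<close>, \<open>\<dots>\<close>.\<close>

lemma attach_cycle_unicycle:
  assumes "0 < k" "k < n" and "pverts H = {..<n - k + 1}"
    and "\<And>i j. (i, j) \<in> parcs H \<longleftrightarrow> i < n - k + 1 \<and> j < n - k + 1 \<and>
      (0 < i \<and> j = p i \<or> 0 < j \<and> i = p j)"
    and "\<And>i. par (k - 1 + Suc i) = (if p (Suc i) = 0 then 0 else k - 1 + p (Suc i))"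
    and p: "\<And>i. p (Suc i) < Suc i"
  shows "attach_cycle k H = unicycle [0..<k] {k..<n} par"
proof -
  let ?f = "\<lambda>i. if i = 0 then 0 else k - 1 + i"
  have img: "?f ` {..<n - k + 1} = insert 0 {k..<n}"
  proof -
    have "x \<in> ?f ` {..<n - k + 1}" if "x \<in> {k..<n}" for x
      using that assms(1,2) by (intro image_eqI[of _ _ "x - k + 1"]) auto
    then show ?thesis using assms(1,2) by auto
  qed
  have V: "pverts (attach_cycle k H) = pverts (unicycle [0..<k] {k..<n} par)"
    unfolding attach_cycle_def Let_def pair_pre_digraph.select_convs assms(3) img
    using assms(1) by (auto simp: cycle_graph_def)
  have tree: "map_prod ?f ?f ` parcs H = {(x, y). x \<in> {k..<n} \<and> y = par x \<or> y \<in> {k..<n} \<and> x = par y}"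
  proof -
    have H: "parcs H = (\<lambda>i. (i, p i)) ` {i. 0 < i \<and> i < n - k + 1}
        \<union> (\<lambda>i. (p i, i)) ` {i. 0 < i \<and> i < n - k + 1}"
    proof -
      have "p i < n - k + 1" if "0 < i" "i < n - k + 1" for i
        using that p[of "i - 1"] by simp
      then show ?thesis using assms(4) by auto
    qed
    have T: "{k..<n} = ?f ` {i. 0 < i \<and> i < n - k + 1}"
    proof -
      have "x \<in> ?f ` {i. 0 < i \<and> i < n - k + 1}" if "x \<in> {k..<n}" for x
        using that assms(1,2) by (intro image_eqI[of _ _ "x - k + 1"]) auto
      then show ?thesis using assms(1,2) by auto
    qed
    have par: "par (?f i) = ?f (p i)" if "0 < i" for i
      using assms(5)[of "i - 1"] that by simp
    have "map_prod ?f ?f ` parcs H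
        = (\<lambda>i. (?f i, ?f (p i))) ` {i. 0 < i \<and> i < n - k + 1}
        \<union> (\<lambda>i. (?f (p i), ?f i)) ` {i. 0 < i \<and> i < n - k + 1}"
      by (simp only: H image_Un image_image map_prod_simp)
    also have "(\<lambda>i. (?f i, ?f (p i))) ` {i. 0 < i \<and> i < n - k + 1}
        = (\<lambda>x. (x, par x)) ` {k..<n}"
      unfolding T image_image by (intro image_cong) (auto simp only: par mem_Collect_eq)
    also have "(\<lambda>i. (?f (p i), ?f i)) ` {i. 0 < i \<and> i < n - k + 1}
        = (\<lambda>x. (par x, x)) ` {k..<n}"
      unfolding T image_image by (intro image_cong) (auto simp only: par mem_Collect_eq)
    finally show ?thesis by auto
  qed
  have "parcs (attach_cycle k H) = parcs (unicycle [0..<k] {k..<n} par)"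
    unfolding attach_cycle_def Let_def pair_pre_digraph.select_convs tree parcs_cycle_graph
    by (auto simp: unicycle_def)
  with V show ?thesis by simp
qed

lemma G_star_eq:
  assumes "0 < k" "k < n"
  shows "G_star k n = unicycle [0..<k] {k..<n} (\<lambda>_. 0)"
  unfolding G_star_def
  by (rule attach_cycle_unicycle[where p = "\<lambda>_. 0"]) (use assms in \<open>auto simp: star_graph_def\<close>)

text \<open>The vertex before \<open>j\<close> on the path 0, \<open>k\<close>, \<open>k + 1\<close>, \<open>\<dots>\<close>.\<close>

definition pred_vertex :: "nat \<Rightarrow> nat \<Rightarrow> nat" where
  "pred_vertex k j = (if j = k then 0 else j - 1)"

lemma G_path_eq:
  assumes "0 < k" "k < n"
  shows "G_path k n = unicycle [0..<k] {k..<n} (pred_vertex k)"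
  unfolding G_path_def
  by (rule attach_cycle_unicycle[where p = "\<lambda>i. i - 1"])
     (use assms in \<open>auto simp: path_graph_def pred_vertex_def\<close>)

lemma rooted_unicycle_upt:
  assumes "3 \<le> k" and "\<And>j. j \<in> {k..<n} \<Longrightarrow> par j = 0 \<or> k \<le> par j \<and> par j < j"
  shows "rooted_unicycle [0..<k] {k..<n} par"
proof
  have "hd [0..<k] = 0" using assms(1) by (simp add: upt_conv_Cons)
  then show "\<exists>d :: nat \<Rightarrow> nat. \<forall>x\<in>{k..<n}. par x = hd [0..<k] \<or> par x \<in> {k..<n} \<and> d (par x) < d x"
    using assms(2) by (intro exI[of _ id]) force
qed (use assms(1) in auto)

lemma relabel_onto_initial_segment:
  assumes "rooted_unicycle cs T par" "set cs \<union> T = {..<n}" "length cs = k"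
    and g: "bij_betw g T {k..<n}"
  obtains f where "bij_betw f {..<n} {..<n}" "map f cs = [0..<k]" "\<And>x. x \<in> T \<Longrightarrow> f x = g x"
proof -
  interpret rooted_unicycle cs T par by fact
  have nth: "bij_betw ((!) cs) {..<k} (set cs)"
    using distinct_cs assms(3) by (simp add: bij_betw_nth)
  let ?h = "the_inv_into {..<k} ((!) cs)"
  let ?f = "\<lambda>x. if x \<in> set cs then ?h x else g x"
  have h: "bij_betw ?h (set cs) {..<k}" by (rule bij_betw_the_inv_into[OF nth])
  have "k \<le> n"
  proof -
    have "card (set cs) \<le> card {..<n}" using assms(2) by (intro card_mono) auto
    then show ?thesis using distinct_card[OF distinct_cs] assms(3) by simp
  qed
  have "bij_betw ?f (set cs) {..<k}" using h by (rule bij_betw_cong[THEN iffD1, rotated]) simp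
  moreover have "bij_betw ?f T {k..<n}"
    using g disjoint by (subst bij_betw_cong[of T ?f g]) auto
  ultimately have "bij_betw ?f (set cs \<union> T) ({..<k} \<union> {k..<n})"
    by (rule bij_betw_combine) auto
  moreover have "{..<k} \<union> {k..<n} = {..<n}" using \<open>k \<le> n\<close> by auto
  ultimately have "bij_betw ?f {..<n} {..<n}" using assms(2) by simp
  moreover have "map ?f cs = [0..<k]"
  proof (rule nth_equalityI)
    fix i assume "i < length (map ?f cs)"
    then have "i < k" using assms(3) by simp
    then have "?h (cs ! i) = i"
      using nth by (intro the_inv_into_f_f) (auto simp: bij_betw_def)
    then show "map ?f cs ! i = [0..<k] ! i" using \<open>i < k\<close> assms(3) by simp
  qed (use assms(3) in simp)
  moreover have "?f x = g x" if "x \<in> T" for x using that disjoint by auto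
  ultimately show ?thesis using that by blast
qed

section \<open>Unfolding to the path\<close>

text \<open>The vertices \<open>k\<close>, \<open>\<dots>\<close>, \<open>n - 1\<close> of a tree with root 0 are numbered in depth-first preorder if and
  only if parents precede their children and edges do not cross: no vertex strictly between \<open>b\<close>
  and its parent has a parent before that of \<open>b\<close>. Unlike a condition on ancestors, this one is easy
  to maintain when a single parent is changed.\<close>

definition preorder_parent :: "nat \<Rightarrow> nat \<Rightarrow> (nat \<Rightarrow> nat) \<Rightarrow> bool" where
  "preorder_parent k n par \<longleftrightarrow>
     (\<forall>j\<in>{k..<n}. (par j = 0 \<or> k \<le> par j) \<and> par j < j) \<and>
     (\<forall>a\<in>{k..<n}. \<forall>b\<in>{k..<n}. par b < a \<and> a < b \<longrightarrow> par b \<le> par a)"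

text \<open>A vertex of maximal rank is a leaf, and a leaf can be inserted directly after its parent without
  creating a crossing. Doubling the labels makes room: the new leaf gets the odd label after that
  of its parent.\<close>

lemma noncrossing_labelling:
  fixes par :: "'a \<Rightarrow> 'a"
  assumes "finite T" "r \<notin> T" "\<And>x. x \<in> T \<Longrightarrow> par x = r \<or> par x \<in> T \<and> d (par x) < (d x :: nat)"
  obtains l :: "'a \<Rightarrow> nat" where "inj_on l (insert r T)" "\<And>x. x \<in> T \<Longrightarrow> l (par x) < l x"
    "\<And>a b. a \<in> T \<Longrightarrow> b \<in> T \<Longrightarrow> l (par b) < l a \<Longrightarrow> l a < l b \<Longrightarrow> l (par b) \<le> l (par a)"
  using assms
proof (induction "card T" arbitrary: T thesis rule: less_induct)
  case less
  show ?case
  proof (cases "T = {}")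
    case True
    then show ?thesis by (intro less.prems(1)[of "\<lambda>_. 0"]) auto
  next
    case False
    then have "Max (d ` T) \<in> d ` T" using less.prems(2) by (intro Max_in) auto
    then obtain z where z: "z \<in> T" "d z = Max (d ` T)" by auto
    have max: "d x \<le> d z" if "x \<in> T" for x using that less.prems(2) by (simp add: z(2))
    have leaf: "par x \<noteq> z" if "x \<in> T" for x
      using less.prems(4)[OF that] max[OF that] z(1) less.prems(3) by auto
    let ?T = "T - {z}"
    have "card ?T < card T" using z(1) less.prems(2) by (intro psubset_card_mono) auto
    moreover have "finite ?T" "r \<notin> ?T" using less.prems by auto
    moreover have "par x = r \<or> par x \<in> ?T \<and> d (par x) < d x" if "x \<in> ?T" for x
      using less.prems(4)[of x] leaf that by auto
    ultimately obtain l :: "'a \<Rightarrow> nat" where l: "inj_on l (insert r ?T)"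
      "\<And>x. x \<in> ?T \<Longrightarrow> l (par x) < l x"
      "\<And>a b. a \<in> ?T \<Longrightarrow> b \<in> ?T \<Longrightarrow> l (par b) < l a \<Longrightarrow> l a < l b \<Longrightarrow> l (par b) \<le> l (par a)"
      using less.hyps[of ?T] by (metis (no_types, lifting))
    let ?l = "\<lambda>x. if x = z then 2 * l (par z) + 1 else 2 * l x"
    show ?thesis
    proof (rule less.prems(1)[of ?l])
      show "inj_on ?l (insert r T)"
      proof (rule inj_onI)
        fix x y assume xy: "x \<in> insert r T" "y \<in> insert r T" "?l x = ?l y"
        then have "x = z \<longleftrightarrow> y = z" by (auto split: if_splits) presburger+
        then show "x = y" using xy l(1) by (auto simp: inj_on_def split: if_splits)
      qed
      fix x assume x: "x \<in> T"
      show "?l (par x) < ?l x" using l(2)[of x] leaf[OF x] x by auto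
    next
      fix a b assume ab: "a \<in> T" "b \<in> T" "?l (par b) < ?l a" "?l a < ?l b"
      show "?l (par b) \<le> ?l (par a)"
        using l(3)[of a b] ab leaf[OF ab(1)] leaf[OF ab(2)]
        by (cases "a = z"; cases "b = z") auto
    qed
  qed
qed

text \<open>Counting the smaller labels compresses a labelling to an initial segment and keeps its order.\<close>

lemma rank_bij:
  fixes l :: "'a \<Rightarrow> nat"
  assumes "finite A" "inj_on l A"
  shows "bij_betw (\<lambda>x. card {y \<in> A. l y < l x}) A {..<card A}"
    and "x \<in> A \<Longrightarrow> y \<in> A \<Longrightarrow> card {z \<in> A. l z < l x} < card {z \<in> A. l z < l y} \<longleftrightarrow> l x < l y"
proof -
  define r where "r x = card {y \<in> A. l y < l x}" for x
  have less: "r x < r y" if "x \<in> A" "l x < l y" for x y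
    unfolding r_def using that assms(1) by (intro psubset_card_mono) auto
  have iff: "r x < r y \<longleftrightarrow> l x < l y" if "x \<in> A" "y \<in> A" for x y
  proof
    assume "r x < r y"
    moreover have "r x = r y" if "l x = l y" using that by (simp add: r_def)
    ultimately show "l x < l y" using less[OF \<open>y \<in> A\<close>, of x] by force
  qed (rule less[OF \<open>x \<in> A\<close>])
  then show "x \<in> A \<Longrightarrow> y \<in> A \<Longrightarrow> card {z \<in> A. l z < l x} < card {z \<in> A. l z < l y} \<longleftrightarrow> l x < l y"
    by (simp add: r_def)
  have inj: "inj_on r A"
  proof (rule inj_onI)
    fix x y assume xy: "x \<in> A" "y \<in> A" "r x = r y"
    then have "l x = l y" using iff[of x y] iff[of y x] by simp
    then show "x = y" using assms(2) xy by (auto simp: inj_on_def)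
  qed
  moreover have "r ` A \<subseteq> {..<card A}"
    unfolding r_def using assms(1) by (auto intro!: psubset_card_mono)
  moreover have "card (r ` A) = card {..<card A}" using inj by (simp add: card_image)
  ultimately have "bij_betw r A {..<card A}"
    by (simp add: bij_betw_def card_subset_eq)
  then show "bij_betw (\<lambda>x. card {y \<in> A. l y < l x}) A {..<card A}"
    by (simp add: r_def [abs_def])
qed

text \<open>Compressing a noncrossing labelling to 0, \<open>k\<close>, \<open>k + 1\<close>, \<open>\<dots>\<close> keeps it noncrossing, since both
  conditions only speak of the order of the labels. The cycle takes the numbers below \<open>k\<close>.\<close>

lemma relabel_to_preorder:
  assumes "rooted_unicycle cs T par" and V: "set cs \<union> T = {..<n}" and len: "length cs = k"
  obtains f par' where "bij_betw f {..<n} {..<n}" "preorder_parent k n par'"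
    "relabel f (unicycle cs T par) = unicycle [0..<k] {k..<n} par'"
proof -
  interpret rooted_unicycle cs T par by fact
  let ?r = "hd cs"
  obtain d :: "nat \<Rightarrow> nat" where d: "\<forall>x\<in>T. par x = ?r \<or> par x \<in> T \<and> d (par x) < d x"
    using ranked by blast
  obtain l :: "nat \<Rightarrow> nat" where l: "inj_on l (insert ?r T)" "\<And>x. x \<in> T \<Longrightarrow> l (par x) < l x"
    "\<And>a b. a \<in> T \<Longrightarrow> b \<in> T \<Longrightarrow> l (par b) < l a \<Longrightarrow> l a < l b \<Longrightarrow> l (par b) \<le> l (par a)"
    using noncrossing_labelling[OF finite_T root_notin_T, of par d] d by metis
  define rank where "rank x = card {y \<in> insert ?r T. l y < l x}" for x
  have fin: "finite (insert ?r T)" using finite_T by simp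
  have rank: "bij_betw rank (insert ?r T) {..<card (insert ?r T)}"
    "\<And>x y. x \<in> insert ?r T \<Longrightarrow> y \<in> insert ?r T \<Longrightarrow> rank x < rank y \<longleftrightarrow> l x < l y"
    using rank_bij[OF fin l(1)] unfolding rank_def by blast+
  have root_min: "l ?r < l x" if "x \<in> T" for x
    using that
  proof (induction "d x" arbitrary: x rule: less_induct)
    case less
    then show ?case using d l(2)[of x] by (metis less_trans)
  qed
  have "{y \<in> insert ?r T. l y < l ?r} = {}" by (auto dest: root_min)
  then have rank_root: "rank ?r = 0" by (simp only: rank_def card.empty)
  have card: "card T + k = n"
  proof -
    have "card (set cs \<union> T) = card (set cs) + card T"
      using finite_T disjoint by (intro card_Un_disjoint) auto
    then show ?thesis using V len distinct_card[OF distinct_cs] by simp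
  qed
  have "bij_betw rank T {1..<card T + 1}"
  proof -
    have "bij_betw rank (insert ?r T - {?r}) ({..<card (insert ?r T)} - {rank ?r})"
      using rank(1) by (intro bij_betw_DiffI) (auto simp: bij_betw_def)
    moreover have "insert ?r T - {?r} = T" using root_notin_T by auto
    moreover have "{..<card (insert ?r T)} - {rank ?r} = {1..<card T + 1}"
      using finite_T root_notin_T rank_root by auto
    ultimately show ?thesis by simp
  qed
  moreover have "bij_betw (\<lambda>i. k - 1 + i) {1..<card T + 1} {k..<n}"
    using card length_cs len by (intro bij_betw_byWitness[where f' = "\<lambda>i. i - (k - 1)"]) auto
  ultimately have "bij_betw ((\<lambda>i. k - 1 + i) \<circ> rank) T {k..<n}"
    by (rule bij_betw_trans)
  then obtain f where f: "bij_betw f {..<n} {..<n}" "map f cs = [0..<k]"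
    "\<And>x. x \<in> T \<Longrightarrow> f x = ((\<lambda>i. k - 1 + i) \<circ> rank) x"
    using relabel_onto_initial_segment[OF assms] by metis
  have f_T: "f x = k - 1 + rank x" if "x \<in> T" for x using f(3)[OF that] by simp
  have "bij_betw f T {k..<n}"
    using bij_betw_cong[of T f, OF f(3)] \<open>bij_betw (_ \<circ> rank) T {k..<n}\<close> by (simp add: comp_def)
  then have img: "f ` T = {k..<n}" and inj: "inj_on f T" by (auto simp: bij_betw_def)
  have f_r: "f ?r = 0"
  proof -
    have "map f cs ! 0 = 0" using f(2) length_cs len by simp
    then show ?thesis using length_cs by (cases cs) auto
  qed
  have rank_pos: "0 < rank x" if "x \<in> T" for x
    using rank(2)[of ?r x] root_min[OF that] that rank_root by simp
  have mono: "f x < f y \<longleftrightarrow> l x < l y" if "x \<in> insert ?r T" "y \<in> insert ?r T" for x y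
  proof -
    have "f x < f y \<longleftrightarrow> rank x < rank y"
      using that f_T f_r rank_pos[of x] rank_pos[of y] rank_root length_cs len by auto
    then show ?thesis using rank(2)[OF that] by simp
  qed
  define par' where "par' j = f (par (the_inv_into T f j))" for j
  have par': "par' (f x) = f (par x)" if "x \<in> T" for x
    using inj that by (simp add: par'_def the_inv_into_f_f)
  have par_in: "par x \<in> insert ?r T" if "x \<in> T" for x using par_cases[OF that] by auto
  have "(par' j = 0 \<or> k \<le> par' j) \<and> par' j < j" if jk: "j \<in> {k..<n}" for j
  proof -
    obtain x where x: "x \<in> T" "j = f x" using jk[folded img] by blast
    have "f (par x) = 0 \<or> k \<le> f (par x)"
      using par_in[OF x(1)] f_r img by auto
    moreover have "f (par x) < f x" using mono[OF par_in] l(2) x(1) by simp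
    ultimately show ?thesis using x par' by simp
  qed
  moreover have "par' j \<le> par' i"
    if ij: "i \<in> {k..<n}" "j \<in> {k..<n}" "par' j < i" "i < j" for i j
  proof -
    obtain x y where x: "x \<in> T" "i = f x" and y: "y \<in> T" "j = f y" using ij(1,2)[folded img] by blast
    have "l (par y) < l x" "l x < l y"
      using ij(3,4) x y par' mono par_in by auto
    then have "l (par y) \<le> l (par x)" using l(3) x y by simp
    then have "f (par y) \<le> f (par x)"
      using mono[OF par_in[OF x(1)] par_in[OF y(1)]] by (simp add: not_less)
    then show ?thesis using x y par' by simp
  qed
  ultimately have "preorder_parent k n par'" unfolding preorder_parent_def by blast
  moreover have "relabel f (unicycle cs T par) = unicycle [0..<k] {k..<n} par'"
    using relabel_unicycle[of T par' f par cs] par' f(2) img by simp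
  ultimately show ?thesis using that f(1) by blast
qed

text \<open>Let \<open>j\<close> be the first vertex whose parent \<open>u\<close> is not its predecessor. The vertices before \<open>j\<close> form a
  path, which contains \<open>u\<close>. As edges do not cross, no vertex after \<open>j\<close> has its parent strictly
  between \<open>u\<close> and \<open>j\<close>. So after hanging \<open>j\<close> below \<open>j - 1\<close>, the path from \<open>u\<close> to \<open>j - 1\<close> does not
  branch and \<open>j\<close> is the only child at its end: lifting it restores the given graph.\<close>

lemma ggs_improves_path:
  assumes k: "3 \<le> k" "k < n" and "preorder_parent k n par"
  shows "ggs_improves (unicycle [0..<k] {k..<n} (pred_vertex k)) (unicycle [0..<k] {k..<n} par)"
  using assms(3)
proof (induction "card {j \<in> {k..<n}. par j \<noteq> pred_vertex k j}" arbitrary: par rule: less_induct)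
  case less
  let ?D = "\<lambda>par. {j \<in> {k..<n}. par j \<noteq> pred_vertex k j}"
  have range: "par j = 0 \<or> k \<le> par j" "par j < j" if "k \<le> j" "j < n" for j
    using less.prems that by (auto simp: preorder_parent_def)
  have nc: "par b \<le> par a" if "par b < a" "a < b" "k \<le> a" "b < n" for a b
    using less.prems that by (auto simp: preorder_parent_def)
  show ?case
  proof (cases "?D par = {}")
    case True
    then have "unicycle [0..<k] {k..<n} par = unicycle [0..<k] {k..<n} (pred_vertex k)"
      by (intro unicycle_cong) auto
    then show ?thesis by (simp add: ggs_improves_refl)
  next
    case False
    define j where "j = Min (?D par)"
    have "j \<in> ?D par" unfolding j_def using False by (intro Min_in) auto
    then have j: "k \<le> j" "j < n" "par j \<noteq> pred_vertex k j" by auto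
    have before: "par i = pred_vertex k i" if "k \<le> i" "i < j" for i
    proof (rule ccontr)
      assume "par i \<noteq> pred_vertex k i"
      then have "i \<in> ?D par" using that j(2) by simp
      then have "j \<le> i" unfolding j_def by (intro Min_le) auto
      then show False using that by simp
    qed
    have "k < j" using j range[of k] by (cases "j = k") (auto simp: pred_vertex_def)
    define u where "u = par j"
    have u: "u = 0 \<or> k \<le> u" "u < j - 1"
      using range[OF j(1,2)] j(3) \<open>k < j\<close> by (auto simp: u_def pred_vertex_def)
    let ?par = "par(j := j - 1)"
    have pre: "preorder_parent k n ?par"
      unfolding preorder_parent_def
    proof (intro conjI ballI impI)
      fix i assume "i \<in> {k..<n}"
      then show "?par i = 0 \<or> k \<le> ?par i" "?par i < i" using range[of i] \<open>k < j\<close> by auto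
    next
      fix a b assume ab: "a \<in> {k..<n}" "b \<in> {k..<n}" "?par b < a \<and> a < b"
      then show "?par b \<le> ?par a" using nc[of b a] by (auto split: if_splits)
    qed
    have "?D ?par \<subseteq> ?D par - {j}" using \<open>k < j\<close> by (auto simp: pred_vertex_def)
    also have "\<dots> \<subset> ?D par" using \<open>j \<in> ?D par\<close> by auto
    finally have "card (?D ?par) < card (?D par)" by (intro psubset_card_mono) auto
    from less.hyps[OF this pre]
    have IH: "ggs_improves (unicycle [0..<k] {k..<n} (pred_vertex k)) (unicycle [0..<k] {k..<n} ?par)" .
    \<comment> \<open>The child of \<open>u\<close> on the path is \<open>s + 1\<close>: for the root 0 this is the first tree vertex \<open>k\<close>.\<close>
    define s where "s = (if u = 0 then k - 1 else u)"
    define m where "m = j - 1 - s"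
    define q where "q i = (if i = 0 then u else s + i)" for i
    have s: "s < j - 1" "k - 1 \<le> s" "u \<le> s" using u k \<open>k < j\<close> by (auto simp: s_def)
    have hd: "hd [0..<k] = 0" using k by (simp add: upt_conv_Cons)
    have rooted: "rooted_unicycle [0..<k] {k..<n} ?par"
      using k(1) pre by (intro rooted_unicycle_upt) (auto simp: preorder_parent_def)
    have path: "descending_path [0..<k] {k..<n} ?par q m"
    proof -
      interpret rooted_unicycle "[0..<k]" "{k..<n}" ?par by (rule rooted)
      show ?thesis
      proof
        show "0 < m" using s by (simp add: m_def)
        show "inj_on q {..m}" using s by (auto simp: inj_on_def q_def)
        show "q 0 = hd [0..<k] \<or> q 0 \<in> {k..<n}" using u j(2) hd by (auto simp: q_def)
        show "q i \<in> {k..<n}" if "0 < i" "i \<le> m" for i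
          using that s j(2) k by (auto simp: q_def m_def)
        show "?par (q (Suc i)) = q i" if "i < m" for i
        proof -
          have "k \<le> s + Suc i" "s + Suc i < j" using that s by (auto simp: m_def)
          then have "?par (q (Suc i)) = pred_vertex k (s + Suc i)"
            using before by (simp add: q_def)
          also have "\<dots> = q i" using u k by (auto simp: q_def s_def pred_vertex_def)
          finally show ?thesis .
        qed
        show "x = q (Suc i)" if "0 < i" "i < m" "x \<in> {k..<n}" "?par x = q i" for i x
        proof -
          have qi: "q i = s + i" "s + i < j - 1" using that by (auto simp: q_def m_def)
          then have "x \<noteq> j" using that(4) by auto
          then have par_x: "par x = s + i" using that(4) qi by simp
          have "x < j"
          proof (rule ccontr)
            assume "\<not> x < j"
            then have "s + i \<le> par j" using nc[of x j] par_x qi \<open>x \<noteq> j\<close> that(3) j(1) by auto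
            then show False using s that(1) by (simp add: u_def)
          qed
          then have "pred_vertex k x = s + i" using before[of x] par_x that(3) by simp
          then have "x = s + Suc i" using s that(1) k by (auto simp: pred_vertex_def split: if_splits)
          then show ?thesis by (simp add: q_def)
        qed
      qed
    qed
    have q_m: "q m = j - 1" using s by (auto simp: q_def m_def)
    have V: "set [0..<k] \<union> {k..<n} = {..<n}" using k by auto
    from ggs_improves_lifted[OF path V]
    have "ggs_improves (unicycle [0..<k] {k..<n} ?par)
        (unicycle [0..<k] {k..<n} (\<lambda>x. if ?par x = q m then q 0 else ?par x))"
      using k by simp
    also have "unicycle [0..<k] {k..<n} (\<lambda>x. if ?par x = q m then q 0 else ?par x)
        = unicycle [0..<k] {k..<n} par"
    proof (rule unicycle_cong)
      fix x assume x: "x \<in> {k..<n}"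
      show "(if ?par x = q m then q 0 else ?par x) = par x"
      proof (cases "x = j")
        case True
        then show ?thesis by (simp add: q_m) (simp add: q_def u_def)
      next
        case False
        have "par x \<noteq> j - 1"
        proof
          assume par_x: "par x = j - 1"
          show False
          proof (cases "x < j")
            case True
            then show False using range(2)[of x] x par_x by simp
          next
            case False
            then have "j - 1 \<le> u" using nc[of x j] \<open>x \<noteq> j\<close> par_x x j \<open>k < j\<close> by (auto simp: u_def)
            then show False using u by simp
          qed
        qed
        then show ?thesis using False by (simp add: q_m)
      qed
    qed
    finally have "ggs_improves (unicycle [0..<k] {k..<n} ?par) (unicycle [0..<k] {k..<n} par)" .
    with IH show ?thesis by (rule ggs_improves_trans)
  qed
qed

section \<open>Extremality\<close>

lemma parcs_unicycle_subset:
  assumes "rooted_unicycle cs T par" "set cs \<union> T = {..<n}"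
  shows "parcs (unicycle cs T par) \<subseteq> {..<n} \<times> {..<n}"
proof -
  interpret rooted_unicycle cs T par by fact
  interpret pair_wf_digraph G by (rule pair_wf_unicycle)
  show ?thesis using in_arcsD1 in_arcsD2 assms(2) by auto
qed

lemma relabelled_unicycle:
  assumes U: "rooted_unicycle cs T par" and V: "set cs \<union> T = {..<n}" and "0 < n"
    and f: "bij_betw f {..<n} {..<n}"
  shows "graph_iso (unicycle cs T par) (relabel f (unicycle cs T par))"
    and "graph_iso (relabel f (unicycle cs T par)) (unicycle cs T par)"
    and "adj_sigma (relabel f (unicycle cs T par)) = adj_sigma (unicycle cs T par)"
    and "wiener (relabel f (unicycle cs T par)) = wiener (unicycle cs T par)"
proof -
  let ?G = "unicycle cs T par"
  interpret rooted_unicycle cs T par by fact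
  have inj: "inj_on f (pverts ?G)" using f V by (simp add: bij_betw_def)
  show "graph_iso ?G (relabel f ?G)" by (rule graph_iso_relabel[OF pair_wf_unicycle inj])
  have "inj_on (the_inv_into (pverts ?G) f) (pverts (relabel f ?G))"
    using inj by (simp add: inj_on_the_inv_into)
  from graph_iso_relabel[OF relabel_wf[OF pair_wf_unicycle] this]
  show "graph_iso (relabel f ?G) ?G"
    by (simp only: relabel_the_inv_into[OF pair_wf_unicycle inj])
  show "adj_sigma (relabel f ?G) = adj_sigma ?G"
    using parcs_unicycle_subset[OF U V] sym_unicycle V f \<open>0 < n\<close>
    by (intro adj_sigma_relabel[where n = n]) auto
  show "wiener (relabel f ?G) = wiener ?G" by (rule wiener_relabel[OF pair_wf_unicycle inj])
qed

theorem corollary21: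
  fixes n k :: nat
  assumes "n > k" and "k \<ge> 3"
  shows "G_star k n \<in> Omega k n \<and> G_path k n \<in> Omega k n \<and>
    (\<forall>G \<in> Omega k n. G_path k n \<le>\<^sub>G\<^sub>G\<^sub>S G \<and> G \<le>\<^sub>G\<^sub>G\<^sub>S G_star k n) \<and>
    (\<forall>G \<in> Omega k n.
       adj_sigma (G_path k n) \<le> adj_sigma G \<and> adj_sigma G \<le> adj_sigma (G_star k n) \<and>
       wiener (G_star k n) \<le> wiener G \<and> wiener G \<le> wiener (G_path k n))"
proof -
  have k: "0 < k" "k < n" "0 < n" using assms by auto
  have V: "set [0..<k] \<union> {k..<n} = {..<n}" using k by auto
  have star: "G_star k n \<in> Omega k n"
    unfolding G_star_eq[OF k(1,2)]
    by (rule unicycle_in_Omega[OF rooted_unicycle_upt V]) (use assms in simp_all)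
  have path: "G_path k n \<in> Omega k n"
    unfolding G_path_eq[OF k(1,2)]
    by (rule unicycle_in_Omega[OF rooted_unicycle_upt V])
       (use assms in \<open>auto simp: pred_vertex_def\<close>)
  have extremal: "G_path k n \<le>\<^sub>G\<^sub>G\<^sub>S G \<and> G \<le>\<^sub>G\<^sub>G\<^sub>S G_star k n \<and>
      adj_sigma (G_path k n) \<le> adj_sigma G \<and> adj_sigma G \<le> adj_sigma (G_star k n) \<and>
      wiener (G_star k n) \<le> wiener G \<and> wiener G \<le> wiener (G_path k n)"
    if G: "G \<in> Omega k n" for G
  proof -
    obtain cs T par where U: "rooted_unicycle cs T par" and G_eq: "G = unicycle cs T par"
      and len: "length cs = k" using Omega_imp_unicycle[OF G] .
    have VT: "set cs \<union> T = {..<n}"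
      using G by (simp add: Omega_def G_eq)
    interpret U: rooted_unicycle cs T par by fact
    let ?S = "unicycle cs T (\<lambda>_. hd cs)"
    have S: "rooted_unicycle cs T (\<lambda>_. hd cs)"
      using U.distinct_cs U.length_cs U.finite_T U.disjoint by unfold_locales auto
    have "card T = card {k..<n}"
    proof -
      have "card (set cs \<union> T) = card (set cs) + card T"
        using U.finite_T U.disjoint by (intro card_Un_disjoint) auto
      then show ?thesis using VT len distinct_card[OF U.distinct_cs] by simp
    qed
    then obtain g where "bij_betw g T {k..<n}"
      using finite_same_card_bij U.finite_T by blast
    then obtain f where f: "bij_betw f {..<n} {..<n}" "map f cs = [0..<k]" "\<And>x. x \<in> T \<Longrightarrow> f x = g x"
      using relabel_onto_initial_segment[OF U VT len] by metis
    have "f ` T = {k..<n}"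
      using f(3) \<open>bij_betw g T {k..<n}\<close> by (auto simp: bij_betw_def)
    moreover have "f (hd cs) = 0"
    proof -
      have "map f cs ! 0 = 0" using f(2) k by simp
      then show ?thesis using U.length_cs by (cases cs) auto
    qed
    ultimately have star_eq: "relabel f ?S = G_star k n"
      using relabel_unicycle[of T "\<lambda>_. 0" f "\<lambda>_. hd cs" cs] f(2) by (simp add: G_star_eq[OF k(1,2)])
    note iso_S = relabelled_unicycle[OF S VT k(3) f(1), unfolded star_eq]
    have up: "ggs_improves G ?S"
      unfolding G_eq by (rule ggs_improves_star[OF U VT k(3)])
    obtain h par' where h: "bij_betw h {..<n} {..<n}" "preorder_parent k n par'"
      and h_eq: "relabel h G = unicycle [0..<k] {k..<n} par'"
      unfolding G_eq using relabel_to_preorder[OF U VT len] .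
    note iso_G = relabelled_unicycle[OF U VT k(3) h(1), folded G_eq]
    have down: "ggs_improves (G_path k n) (relabel h G)"
      unfolding h_eq G_path_eq[OF k(1,2)] by (rule ggs_improves_path[OF assms(2,1) h(2)])
    show ?thesis
      using up down iso_S iso_G unfolding ggs_improves_def ggs_le_def by auto
  qed
  show ?thesis using star path extremal by blast
qed

end
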